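(* Let $E$ be a symmetric space on $I=[0,1)$ with fundamental function $\phi$, and let $x\in E$. Then the following are equivalent: (a) $x$ is an LLUKM point of $E$ and $\lim_{t\to0^+}x^*(t)\phi(t)=0$; (b) $x$ is an LKM point of $E$ and a point of order continuity of $E$.
   Context: Let $I=[0,1)$ with Lebesgue measure $\mu$, and let $L^0$ be the set of (equivalence classes of) extended real valued measurable functions on $I$. A Banach function space $(E,\|\cdot\|_E)$ is a Banach lattice that is a sublattice of $L^0$ such that (1) $x\in L^0$, $y\in E$, $|x|\le|y|$ a.e. imply $x\in E$ and $\|x\|_E\le\|y\|_E$; (2) $E$ contains a strictly positive function. $E^+=\{x\in E:x\ge0\}$. For $x\in L^0$: $d_x(\lambda)=\mu\{s\in I:|x(s)|>\lambda\}$, $x^*(t)=\inf\{\lambda>0:d_x(\lambda)\le t\}$, $x^{**}(t)=\frac1t\int_0^t x^*(s)\,ds$. $E$ is symmetric if $x\in L^0$, $y\in E$, $d_x=d_y$ imply $x\in E$ and $\|x\|_E=\|y\|_E$. Its fundamental function is $\phi(t)=\|\chi_{(0,t)}\|_E$. Standing assumption: $E$ has the Fatou property, i.e. if $(x_n)\subset E^+$, $\sup_n\|x_n\|_E<\infty$ and $x_n\uparrow x\in L^0$, then $x\in E$ and $\|x_n\|_E\uparrow\|x\|_E$. For $x,y\in L^1+L^\infty$, $x\prec y$ means $x^{**}(t)\le y^{**}(t)$ for all $t>0$. $x\in E$ is a point of order continuity if for every $(x_n)\subset E^+$ with $x_n\le|x|$ and $x_n\to0$ a.e. we have $\|x_n\|_E\to0$.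 $x\in E$ is an LKM point (point of lower $K$-monotonicity) if for every $y\in E$ with $x^*\ne y^*$ and $y\prec x$ we have $\|y\|_E<\|x\|_E$. $x\in E$ is an LLUKM point (point of lower local uniform $K$-monotonicity) if for every $(x_n)\subset E$ with $x_n\prec x$ for all $n$ and $\|x_n\|_E\to\|x\|_E$ we have $\|x^*-x_n^*\|_E\to0$. *)

theory Defs
  imports "HOL-Analysis.Analysis"
begin

text \<open>
  Elements of \<open>L0\<close> are represented by extended real valued functions on \<open>real\<close>; only their
  values on \<open>[0,1)\<close>, up to null sets, matter. Relations between elements are stated almost
  everywhere, so no quotient is formed.
\<close>

abbreviation unit_leb :: "real measure" where
  "unit_leb \<equiv> lebesgue_on {0..<1}"

definition L0 :: "(real \<Rightarrow> ereal) set" where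
  "L0 = borel_measurable unit_leb"

text \<open>
  The space is a carrier \<open>E\<close> together with a norm \<open>N\<close>, whose values outside \<open>E\<close> are irrelevant.
  A linear space of extended real valued functions has to consist of functions that are finite
  almost everywhere, since otherwise \<open>x + (- x) = 0\<close> fails; \<open>finite_ae\<close> makes this explicit,
  because addition on type \<open>ereal\<close> is a total operation. That \<open>E\<close> and \<open>N\<close> respect equality
  almost everywhere is a consequence of \<open>ideal\<close>.
\<close>

locale banach_function_space =
  fixes E :: "(real \<Rightarrow> ereal) set" and N :: "(real \<Rightarrow> ereal) \<Rightarrow> real"
  assumes subset_L0: "E \<subseteq> L0"
    and finite_ae: "x \<in> E \<Longrightarrow> AE s in unit_leb. \<bar>x s\<bar> \<noteq> \<infinity>"
    and zero_mem: "(\<lambda>s. 0) \<in> E"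
    and add_mem: "x \<in> E \<Longrightarrow> y \<in> E \<Longrightarrow> (\<lambda>s. x s + y s) \<in> E"
    and scale_mem: "x \<in> E \<Longrightarrow> (\<lambda>s. ereal c * x s) \<in> E"
    and sup_mem: "x \<in> E \<Longrightarrow> y \<in> E \<Longrightarrow> (\<lambda>s. max (x s) (y s)) \<in> E"
    and inf_mem: "x \<in> E \<Longrightarrow> y \<in> E \<Longrightarrow> (\<lambda>s. min (x s) (y s)) \<in> E"
    and norm_nonneg: "x \<in> E \<Longrightarrow> 0 \<le> N x"
    and norm_zero_iff: "x \<in> E \<Longrightarrow> N x = 0 \<longleftrightarrow> (AE s in unit_leb. x s = 0)"
    and norm_scale: "x \<in> E \<Longrightarrow> N (\<lambda>s. ereal c * x s) = \<bar>c\<bar> * N x"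
    and norm_triangle: "x \<in> E \<Longrightarrow> y \<in> E \<Longrightarrow> N (\<lambda>s. x s + y s) \<le> N x + N y"
    and complete:
      "(\<And>n. X n \<in> E) \<Longrightarrow>
       (\<And>e. 0 < e \<Longrightarrow> \<exists>k. \<forall>m\<ge>k. \<forall>n\<ge>k. N (\<lambda>s. X m s - X n s) < e) \<Longrightarrow>
       \<exists>x\<in>E. (\<lambda>n. N (\<lambda>s. X n s - x s)) \<longlonglongrightarrow> 0"
    and ideal:
      "x \<in> L0 \<Longrightarrow> y \<in> E \<Longrightarrow> (AE s in unit_leb. \<bar>x s\<bar> \<le> \<bar>y s\<bar>) \<Longrightarrow> x \<in> E \<and> N x \<le> N y"
    and strictly_positive: "\<exists>w\<in>E. AE s in unit_leb. 0 < w s"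

definition dist_fun :: "(real \<Rightarrow> ereal) \<Rightarrow> real \<Rightarrow> real" where
  "dist_fun x l = measure unit_leb {s \<in> {0..<1}. \<bar>x s\<bar> > ereal l}"

text \<open>The infimum is taken in \<open>ereal\<close>, so that it is \<open>\<infinity>\<close> for the empty set.\<close>

definition decr_rearr :: "(real \<Rightarrow> ereal) \<Rightarrow> real \<Rightarrow> ereal" where
  "decr_rearr x t = Inf {ereal l | l. l > 0 \<and> dist_fun x l \<le> t}"

definition maximal_fun :: "(real \<Rightarrow> ereal) \<Rightarrow> real \<Rightarrow> ennreal" where
  "maximal_fun x t = (\<integral>\<^sup>+s\<in>{0<..<t}. e2ennreal (decr_rearr x s) \<partial>lborel) / ennreal t"

text \<open>
  On \<open>[0,1)\<close> one has \<open>L1 + Linf = L1\<close>, and every symmetric space is contained in it; the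
  relation is only used between members of such a space.
\<close>

definition submajorized :: "(real \<Rightarrow> ereal) \<Rightarrow> (real \<Rightarrow> ereal) \<Rightarrow> bool" (infix "\<prec>" 50) where
  "x \<prec> y \<longleftrightarrow> (\<forall>t>0. maximal_fun x t \<le> maximal_fun y t)"

locale symmetric_space = banach_function_space +
  assumes symmetric: "x \<in> L0 \<Longrightarrow> y \<in> E \<Longrightarrow> dist_fun x = dist_fun y \<Longrightarrow> x \<in> E \<and> N x = N y"

definition fatou_property ::
    "(real \<Rightarrow> ereal) set \<Rightarrow> ((real \<Rightarrow> ereal) \<Rightarrow> real) \<Rightarrow> bool" where
  "fatou_property E N \<longleftrightarrow>
     (\<forall>X x. (\<forall>n::nat. X n \<in> E \<and> (AE s in unit_leb. 0 \<le> X n s)) \<longrightarrow>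
        bdd_above (range (\<lambda>n. N (X n))) \<longrightarrow>
        x \<in> L0 \<longrightarrow>
        (AE s in unit_leb. incseq (\<lambda>n. X n s) \<and> (\<lambda>n. X n s) \<longlonglongrightarrow> x s) \<longrightarrow>
        x \<in> E \<and> incseq (\<lambda>n. N (X n)) \<and> (\<lambda>n. N (X n)) \<longlonglongrightarrow> N x)"

definition fundamental_fun :: "((real \<Rightarrow> ereal) \<Rightarrow> real) \<Rightarrow> real \<Rightarrow> real" where
  "fundamental_fun N t = N (indicator {0<..<t})"

definition order_continuity_point ::
    "(real \<Rightarrow> ereal) set \<Rightarrow> ((real \<Rightarrow> ereal) \<Rightarrow> real) \<Rightarrow> (real \<Rightarrow> ereal) \<Rightarrow> bool" where
  "order_continuity_point E N x \<longleftrightarrow> x \<in> E \<and>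
     (\<forall>X. (\<forall>n::nat. X n \<in> E \<and> (AE s in unit_leb. 0 \<le> X n s \<and> X n s \<le> \<bar>x s\<bar>)) \<longrightarrow>
        (AE s in unit_leb. (\<lambda>n. X n s) \<longlonglongrightarrow> 0) \<longrightarrow>
        (\<lambda>n. N (X n)) \<longlonglongrightarrow> 0)"

definition LKM_point ::
    "(real \<Rightarrow> ereal) set \<Rightarrow> ((real \<Rightarrow> ereal) \<Rightarrow> real) \<Rightarrow> (real \<Rightarrow> ereal) \<Rightarrow> bool" where
  "LKM_point E N x \<longleftrightarrow> x \<in> E \<and>
     (\<forall>y\<in>E. decr_rearr x \<noteq> decr_rearr y \<longrightarrow> y \<prec> x \<longrightarrow> N y < N x)"

definition LLUKM_point ::
    "(real \<Rightarrow> ereal) set \<Rightarrow> ((real \<Rightarrow> ereal) \<Rightarrow> real) \<Rightarrow> (real \<Rightarrow> ereal) \<Rightarrow> bool" where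
  "LLUKM_point E N x \<longleftrightarrow> x \<in> E \<and>
     (\<forall>X. (\<forall>n::nat. X n \<in> E \<and> X n \<prec> x) \<longrightarrow>
        (\<lambda>n. N (X n)) \<longlonglongrightarrow> N x \<longrightarrow>
        (\<lambda>n. N (\<lambda>s. decr_rearr x s - decr_rearr (X n) s)) \<longlonglongrightarrow> 0)"

end

theory Submission
  imports Defs "HOL-Library.Diagonal_Subsequence"
begin

text \<open>
  By the Fatou property the norm is monotone under submajorization: decreasing functions are
  approximated from below by step functions on dyadic grids, and for these the claim is the
  Hardy--Littlewood--Polya theorem, proved with transfers between two coordinates.

  Unless \<open>x = 0\<close>, order continuity of \<open>x\<close> amounts to two conditions: the fundamental function
  vanishes at \<open>0\<close>, and the norm of \<open>(|x| - k)\<^sup>+\<close> tends to \<open>0\<close>. From (a), the first follows from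
  \<open>x\<^sup>*(t) \<phi>(t) \<rightarrow> 0\<close>, and the second by applying the LLUKM property to \<open>min |x| k\<close>; that an LLUKM
  point is an LKM point follows by testing with constant sequences.

  From (b), let \<open>x\<^sub>n\<close> be submajorized by \<open>x\<close> with norms tending to that of \<open>x\<close>. By Helly's theorem
  a subsequence of the rearrangements converges almost everywhere to a decreasing \<open>y\<close>, and \<open>y\<close> is
  submajorized by \<open>x\<close>. On \<open>(0,t)\<close> the rearrangements have norm at most that of \<open>x\<^sup>* \<chi>\<^bsub>(0,t)\<^esub>\<close>,
  which is small for small \<open>t\<close>; on \<open>[t,1)\<close> they are uniformly bounded and converge in norm. Hence
  the norm of \<open>y\<close> is at least that of \<open>x\<close>, the LKM property yields \<open>y\<^sup>* = x\<^sup>*\<close>, and the same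
  splitting gives convergence in norm.
\<close>

section \<open>Decreasing rearrangements\<close>

lemma up_closed_sets_borel:
  fixes U :: "real set"
  assumes "\<And>s t. s \<in> U \<Longrightarrow> s \<le> t \<Longrightarrow> t \<in> U"
  shows "U \<in> sets borel"
proof -
  have "mono (indicator U :: real \<Rightarrow> real)"
    using assms by (auto simp: mono_def indicator_def)
  then have "(indicator U :: real \<Rightarrow> real) \<in> borel_measurable borel"
    by (rule borel_measurable_mono)
  then show ?thesis by (simp add: borel_measurable_indicator_iff)
qed

lemma borel_measurable_antimono:
  fixes f :: "real \<Rightarrow> ereal"
  assumes "antimono f"
  shows "f \<in> borel_measurable borel"
proof (rule borel_measurableI_less)
  fix y
  show "{t \<in> space borel. f t < y} \<in> sets borel"
    using assms by (intro up_closed_sets_borel) (auto dest: antimonoD order.strict_trans1)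
qed

lemma measurable_unit_leb [measurable (raw)]:
  assumes "f \<in> borel_measurable borel"
  shows "f \<in> borel_measurable unit_leb"
proof -
  have "f \<in> borel_measurable lebesgue"
    using assms by (simp add: measurable_completion)
  then show ?thesis by (rule measurable_restrict_space1)
qed

lemma antimono_L0: "antimono f \<Longrightarrow> f \<in> L0"
  unfolding L0_def by (intro measurable_unit_leb borel_measurable_antimono)

lemma space_unit_leb [simp]: "space unit_leb = {0..<1}"
  by (simp add: space_restrict_space)

lemma finite_measure_unit_leb: "finite_measure unit_leb"
  by (rule finite_measure_lebesgue_on) (simp add: fmeasurable_def)

lemma measure_unit_leb: "A \<subseteq> {0..<1} \<Longrightarrow> measure unit_leb A = measure lebesgue A"
  by (rule measure_restrict_space) auto

lemma measure_unit_leb_le_1: "measure unit_leb A \<le> 1"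
proof -
  interpret finite_measure unit_leb by (rule finite_measure_unit_leb)
  have "measure unit_leb A \<le> measure unit_leb (space unit_leb)" by (rule bounded_measure)
  also have "\<dots> = 1" by (simp add: measure_unit_leb)
  finally show ?thesis .
qed

text \<open>The endpoint \<open>0\<close> joins the exceptional set, because decreasing functions
  may be infinite there; properties then have to be checked on the open interval only.\<close>

lemma AE_unit_lebI:
  assumes "countable C" and "\<And>s. 0 < s \<Longrightarrow> s < 1 \<Longrightarrow> s \<notin> C \<Longrightarrow> P s"
  shows "AE s in unit_leb. P s"
proof -
  have "insert 0 C \<in> null_sets lborel"
    using assms(1) by (intro countable_imp_null_set_lborel) auto
  then have "AE s in lebesgue. s \<notin> insert 0 C"
    by (intro AE_not_in null_sets_completionI)
  then have "AE s in lebesgue. s \<in> {0..<1} \<longrightarrow> P s"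
    by eventually_elim (use assms(2) in force)
  then show ?thesis by (subst AE_restrict_space_iff) auto
qed

lemma AE_unit_lebI_all:
  assumes "\<And>s. 0 < s \<Longrightarrow> s < 1 \<Longrightarrow> P s"
  shows "AE s in unit_leb. P s"
  using assms by (intro AE_unit_lebI[of "{}"]) auto

lemma sets_unit_leb_level:
  assumes "x \<in> L0"
  shows "{s \<in> {0..<1}. \<bar>x s\<bar> > c} \<in> sets unit_leb"
proof -
  have [measurable]: "x \<in> borel_measurable unit_leb" using assms by (simp add: L0_def)
  have "{s \<in> space unit_leb. \<bar>x s\<bar> > c} \<in> sets unit_leb" by measurable
  then show ?thesis by simp
qed

section \<open>The distribution function\<close>

lemma dist_fun_nonneg: "0 \<le> dist_fun x l"
  by (simp add: dist_fun_def)

lemma dist_fun_le_1: "dist_fun x l \<le> 1"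
  unfolding dist_fun_def by (rule measure_unit_leb_le_1)

lemma dist_fun_neg: "l < 0 \<Longrightarrow> dist_fun x l = 1"
proof -
  assume l: "l < 0"
  have "ereal l < \<bar>x s\<bar>" for s
    using l by (intro less_le_trans[of "ereal l" 0 "\<bar>x s\<bar>"]) auto
  then have "{s \<in> {0..<1}. \<bar>x s\<bar> > ereal l} = {0..<1}" by auto
  then show ?thesis by (simp add: dist_fun_def measure_unit_leb)
qed

lemma dist_fun_mono:
  assumes "y \<in> L0" and "AE s in unit_leb. \<bar>x s\<bar> \<le> \<bar>y s\<bar>"
  shows "dist_fun x l \<le> dist_fun y l"
proof -
  interpret finite_measure unit_leb by (rule finite_measure_unit_leb)
  show ?thesis unfolding dist_fun_def
    by (rule finite_measure_mono_AE) (use assms sets_unit_leb_level in \<open>auto elim!: eventually_mono intro: less_le_trans\<close>)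
qed

lemma dist_fun_cong_AE:
  assumes "x \<in> L0" "y \<in> L0" and "AE s in unit_leb. x s = y s"
  shows "dist_fun x = dist_fun y"
  using assms by (intro ext antisym dist_fun_mono) (auto elim!: eventually_mono)

lemma dist_fun_antimono:
  assumes "x \<in> L0" "l \<le> m"
  shows "dist_fun x m \<le> dist_fun x l"
proof -
  interpret finite_measure unit_leb by (rule finite_measure_unit_leb)
  have "{s \<in> {0..<1}. \<bar>x s\<bar> > ereal m} \<subseteq> {s \<in> {0..<1}. \<bar>x s\<bar> > ereal l}"
    using assms(2) le_less_trans[of "ereal l" "ereal m"] by auto
  then show ?thesis unfolding dist_fun_def
    by (rule finite_measure_mono) (rule sets_unit_leb_level[OF assms(1)])
qed

text \<open>Right continuity of the distribution function: the level sets for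
  \<open>l + 1/(n+1)\<close> increase to the level set for \<open>l\<close>, so their measures
  eventually exceed \<open>s\<close> too.\<close>

lemma dist_fun_right_open:
  assumes x: "x \<in> L0" and s: "s < dist_fun x l"
  obtains m where "l < m" "s < dist_fun x m"
proof -
  interpret finite_measure unit_leb by (rule finite_measure_unit_leb)
  define A where "A n = {s \<in> {0..<1}. \<bar>x s\<bar> > ereal (l + inverse (real (Suc n)))}" for n
  have "range A \<subseteq> sets unit_leb"
    unfolding A_def using sets_unit_leb_level[OF x] by auto
  moreover have "incseq A"
  proof (rule incseq_SucI)
    fix n
    have "inverse (real (Suc (Suc n))) \<le> inverse (real (Suc n))" by (simp add: field_simps)
    then show "A n \<le> A (Suc n)" unfolding A_def
      by (auto intro: le_less_trans[rotated])
  qed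
  ultimately have "(\<lambda>n. measure unit_leb (A n)) \<longlonglongrightarrow> measure unit_leb (\<Union>n. A n)"
    by (rule finite_Lim_measure_incseq)
  also have "(\<Union>n. A n) = {s \<in> {0..<1}. \<bar>x s\<bar> > ereal l}"
  proof (intro equalityI subsetI)
    fix t assume "t \<in> (\<Union>n. A n)"
    then obtain n where "t \<in> {0..<1}" "\<bar>x t\<bar> > ereal (l + inverse (real (Suc n)))"
      by (auto simp: A_def)
    moreover from this(2) have "ereal l < \<bar>x t\<bar>"
      by (rule less_trans[rotated]) simp
    ultimately show "t \<in> {s \<in> {0..<1}. \<bar>x s\<bar> > ereal l}"
      by auto
  next
    fix t assume t: "t \<in> {s \<in> {0..<1}. \<bar>x s\<bar> > ereal l}"
    then obtain z where z: "ereal l < ereal z" "ereal z < \<bar>x t\<bar>" using ereal_dense2 by blast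
    then obtain n where "inverse (real (Suc n)) < z - l" using reals_Archimedean[of "z - l"] by auto
    then have "ereal (l + inverse (real (Suc n))) < ereal z" by simp
    also note z(2)
    finally have "t \<in> A n" using t by (simp add: A_def)
    then show "t \<in> (\<Union>n. A n)" by auto
  qed
  finally have "(\<lambda>n. measure unit_leb (A n)) \<longlonglongrightarrow> dist_fun x l" by (simp add: dist_fun_def)
  then have "eventually (\<lambda>n. s < measure unit_leb (A n)) sequentially"
    using s by (rule order_tendstoD)
  then obtain n where "s < measure unit_leb (A n)" by (auto simp: eventually_sequentially)
  then show ?thesis
    by (intro that[of "l + inverse (real (Suc n))"]) (auto simp: dist_fun_def A_def)
qed

section \<open>The decreasing rearrangement as generalized inverse of the distribution
  function\<close>

lemma decr_rearr_nonneg: "0 \<le> decr_rearr x t"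
  unfolding decr_rearr_def by (rule Inf_greatest) auto

lemma antimono_decr_rearr: "antimono (decr_rearr x)"
  unfolding decr_rearr_def by (rule antimonoI) (rule Inf_superset_mono, auto)

lemma decr_rearr_L0: "decr_rearr x \<in> L0"
  by (intro antimono_L0 antimono_decr_rearr)

lemma decr_rearr_cong: "dist_fun x = dist_fun y \<Longrightarrow> decr_rearr x = decr_rearr y"
  by (simp add: decr_rearr_def fun_eq_iff)

lemma decr_rearr_mono:
  assumes "y \<in> L0" and "AE s in unit_leb. \<bar>x s\<bar> \<le> \<bar>y s\<bar>"
  shows "decr_rearr x t \<le> decr_rearr y t"
  unfolding decr_rearr_def
  by (rule Inf_superset_mono) (auto intro: order_trans[OF dist_fun_mono[OF assms]])

lemma decr_rearr_le:
  assumes "0 < l" "dist_fun x l \<le> t"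
  shows "decr_rearr x t \<le> ereal l"
  unfolding decr_rearr_def by (rule Inf_lower) (use assms in auto)

text \<open>The forward direction needs only that the distribution function decreases. The backward
  direction needs its right continuity, which yields a level \<open>m\<close> strictly above
  \<open>l\<close> that is a lower bound of the infimum.\<close>

lemma less_decr_rearr_iff:
  assumes "x \<in> L0" "0 \<le> l"
  shows "ereal l < decr_rearr x t \<longleftrightarrow> t < dist_fun x l"
proof
  assume lt: "ereal l < decr_rearr x t"
  show "t < dist_fun x l"
  proof (rule ccontr)
    assume "\<not> t < dist_fun x l"
    then have le: "dist_fun x l \<le> t" by simp
    obtain z where z: "ereal l < ereal z" "ereal z < decr_rearr x t"
      using ereal_dense2[OF lt] by blast
    then have "dist_fun x z \<le> t"
      using le dist_fun_antimono[OF assms(1), of l z] by simp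
    then have "decr_rearr x t \<le> ereal z" using z assms(2) by (intro decr_rearr_le) auto
    with z show False by simp
  qed
next
  assume "t < dist_fun x l"
  then obtain m where m: "l < m" "t < dist_fun x m" by (rule dist_fun_right_open[OF assms(1)])
  have "ereal m \<le> decr_rearr x t"
    unfolding decr_rearr_def
  proof (rule Inf_greatest)
    fix y assume "y \<in> {ereal l |l. 0 < l \<and> dist_fun x l \<le> t}"
    then obtain k where k: "y = ereal k" "dist_fun x k \<le> t" by auto
    then have "m \<le> k" using m dist_fun_antimono[OF assms(1), of k m] by linarith
    then show "ereal m \<le> y" by (simp add: k)
  qed
  then show "ereal l < decr_rearr x t" using m less_le_trans[of "ereal l" "ereal m"] by simp
qed

text \<open>By \<open>less_decr_rearr_iff\<close> the level set above \<open>l \<ge> 0\<close> is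
  the interval from \<open>0\<close> to \<open>dist_fun x l\<close>, so its length is the value
  sought.\<close>

lemma dist_fun_decr_rearr:
  assumes "x \<in> L0"
  shows "dist_fun (decr_rearr x) = dist_fun x"
proof
  fix l
  show "dist_fun (decr_rearr x) l = dist_fun x l"
  proof (cases "l < 0")
    case True then show ?thesis by (simp add: dist_fun_neg)
  next
    case False
    then have "{s \<in> {0..<1}. \<bar>decr_rearr x s\<bar> > ereal l} = {0..<dist_fun x l}"
      using dist_fun_le_1[of x l]
      by (auto simp: less_decr_rearr_iff[OF assms] abs_ereal_ge0[OF decr_rearr_nonneg])
    then have "dist_fun (decr_rearr x) l = measure unit_leb {0..<dist_fun x l}"
      by (simp add: dist_fun_def)
    also have "\<dots> = dist_fun x l"
      using dist_fun_le_1[of x l] dist_fun_nonneg[of x l] by (subst measure_unit_leb) auto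
    finally show ?thesis .
  qed
qed

text \<open>Reflection at \<open>1/2\<close> turns the level sets of the rearrangement into
  intervals of the same length that end at \<open>1\<close>.\<close>

lemma dist_fun_reflect_decr_rearr:
  assumes "x \<in> L0"
  shows "dist_fun (\<lambda>s. decr_rearr x (1 - s)) = dist_fun x"
proof
  fix l
  show "dist_fun (\<lambda>s. decr_rearr x (1 - s)) l = dist_fun x l"
  proof (cases "l < 0")
    case True then show ?thesis by (simp add: dist_fun_neg)
  next
    case False
    then have "{s \<in> {0..<1}. \<bar>decr_rearr x (1 - s)\<bar> > ereal l} = {1 - dist_fun x l<..<1}"
      using dist_fun_le_1[of x l]
      by (auto simp: less_decr_rearr_iff[OF assms] abs_ereal_ge0[OF decr_rearr_nonneg])
    then have "dist_fun (\<lambda>s. decr_rearr x (1 - s)) l = measure unit_leb {1 - dist_fun x l<..<1}"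
      by (simp add: dist_fun_def)
    also have "\<dots> = dist_fun x l"
      using dist_fun_le_1[of x l] dist_fun_nonneg[of x l] by (subst measure_unit_leb) auto
    finally show ?thesis .
  qed
qed

text \<open>A rational \<open>q\<close> strictly between \<open>g t\<close> and \<open>f t\<close>
  determines \<open>t\<close>: if it also served for some \<open>s > t\<close>, then
  \<open>q < f s \<le> g t < q\<close>. Thus the exceptional set is a countable union of sets with
  at most one point.\<close>

lemma countable_crossing:
  fixes f g :: "real \<Rightarrow> ereal"
  assumes "\<And>s t. t < s \<Longrightarrow> t \<in> I \<Longrightarrow> s \<in> I \<Longrightarrow> f s \<le> g t"
  shows "countable {t \<in> I. g t < f t}"
proof -
  define Q where "Q q = {t \<in> I. g t < ereal q \<and> ereal q < f t}" for q
  have "countable (Q q)" for q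
  proof -
    have "s = t" if "s \<in> Q q" "t \<in> Q q" for s t
    proof (rule ccontr)
      assume "s \<noteq> t"
      then consider "s < t" | "t < s" by linarith
      then show False
      proof cases
        case 1 then show False using that assms[of s t] by (fastforce simp: Q_def)
      next
        case 2 then show False using that assms[of t s] by (fastforce simp: Q_def)
      qed
    qed
    then have "\<exists>a. Q q \<subseteq> {a}" by blast
    then show ?thesis by (meson countable_empty countable_insert countable_subset)
  qed
  then have "countable (\<Union>q\<in>\<rat>. Q q)" using countable_rat by auto
  moreover have "{t \<in> I. g t < f t} \<subseteq> (\<Union>q\<in>\<rat>. Q q)"
  proof
    fix t assume t: "t \<in> {t \<in> I. g t < f t}"
    then obtain a where a: "g t < ereal a" "ereal a < f t" using ereal_dense2 by blast
    obtain b where b: "ereal a < ereal b" "ereal b < f t" using ereal_dense2[OF a(2)] by blast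
    obtain q where "q \<in> \<rat>" "a < q" "q < b" using Rats_dense_in_real b(1) by auto
    then have "t \<in> Q q" unfolding Q_def using a b t
      by (auto intro: less_trans[of _ "ereal _"])
    then show "t \<in> (\<Union>q\<in>\<rat>. Q q)" using \<open>q \<in> \<rat>\<close> by auto
  qed
  ultimately show ?thesis by (rule countable_subset[rotated])
qed

text \<open>For a level \<open>l\<close> above \<open>f t\<close>, monotonicity confines the level
  set to the points before \<open>t\<close>, which have measure at most \<open>t\<close>.\<close>

lemma decr_rearr_le_antimono:
  assumes "antimono f" and "\<And>s. 0 \<le> f s" and "0 < t"
  shows "decr_rearr f t \<le> f t"
proof (rule ccontr)
  assume "\<not> decr_rearr f t \<le> f t"
  then have "f t < decr_rearr f t" by simp
  then obtain l where l: "f t < ereal l" "ereal l < decr_rearr f t" using ereal_dense2 by blast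
  have "0 \<le> l" using le_less_trans[OF assms(2)[of t] l(1)] by simp
  then have "t < dist_fun f l" using l less_decr_rearr_iff[OF antimono_L0[OF assms(1)]] by blast
  moreover have "dist_fun f l \<le> t"
  proof (cases "t < 1")
    case True
    interpret finite_measure unit_leb by (rule finite_measure_unit_leb)
    have "{s \<in> {0..<1}. \<bar>f s\<bar> > ereal l} \<subseteq> {0..<t}"
    proof
      fix s assume s: "s \<in> {s \<in> {0..<1}. \<bar>f s\<bar> > ereal l}"
      have "\<not> t \<le> s"
      proof
        assume "t \<le> s"
        then have "f s \<le> f t" using assms(1) by (simp add: antimonoD)
        then show False using s l assms(2)[of s] by auto
      qed
      then show "s \<in> {0..<t}" using s by auto
    qed
    then have "dist_fun f l \<le> measure unit_leb {0..<t}" unfolding dist_fun_def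
      by (rule finite_measure_mono) (use True in \<open>auto simp: sets_restrict_space_iff\<close>)
    also have "\<dots> = t" using True assms(3) by (subst measure_unit_leb) auto
    finally show ?thesis .
  next
    case False then show ?thesis using dist_fun_le_1[of f l] by simp
  qed
  ultimately show False by simp
qed

text \<open>For a level \<open>l\<close> below \<open>f s\<close>, the level set contains all points
  before \<open>s\<close>, hence has measure greater than \<open>t\<close>. The two arguments differ
  because \<open>f\<close> may jump at \<open>t\<close>, whereas the rearrangement is right
  continuous.\<close>

lemma antimono_le_decr_rearr:
  assumes "antimono f" and "\<And>s. 0 \<le> f s" and "0 \<le> t" "t < s" "s < 1"
  shows "f s \<le> decr_rearr f t"
proof (rule ccontr)
  assume "\<not> f s \<le> decr_rearr f t"
  then have "decr_rearr f t < f s" by simp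
  then obtain l where l: "decr_rearr f t < ereal l" "ereal l < f s" using ereal_dense2 by blast
  have l0: "0 \<le> l" using le_less_trans[OF decr_rearr_nonneg[of f t] l(1)] by simp
  interpret finite_measure unit_leb by (rule finite_measure_unit_leb)
  have "{0..<s} \<subseteq> {s \<in> {0..<1}. \<bar>f s\<bar> > ereal l}"
  proof
    fix r assume r: "r \<in> {0..<s}"
    then have "f s \<le> f r" using assms(1) by (auto intro: antimonoD)
    then show "r \<in> {s \<in> {0..<1}. \<bar>f s\<bar> > ereal l}" using r l assms(2,5) by auto
  qed
  then have "measure unit_leb {0..<s} \<le> dist_fun f l" unfolding dist_fun_def
    by (rule finite_measure_mono) (rule sets_unit_leb_level[OF antimono_L0[OF assms(1)]])
  moreover have "measure unit_leb {0..<s} = s" using assms by (subst measure_unit_leb) auto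
  ultimately have "t < dist_fun f l" using assms by simp
  then have "ereal l < decr_rearr f t"
    using less_decr_rearr_iff[OF antimono_L0[OF assms(1)] l0] by blast
  with l show False by simp
qed

lemma decr_rearr_antimono_AE:
  assumes "antimono f" and "\<And>s. 0 \<le> f s"
  shows "AE s in unit_leb. decr_rearr f s = f s"
proof (rule AE_unit_lebI)
  show "countable {t \<in> {0<..<1}. decr_rearr f t < f t}"
    by (rule countable_crossing) (use antimono_le_decr_rearr[OF assms] in auto)
  show "decr_rearr f s = f s"
    if "0 < s" "s < 1" "s \<notin> {t \<in> {0<..<1}. decr_rearr f t < f t}" for s
    using that decr_rearr_le_antimono[OF assms, of s] by auto
qed

text \<open>A diagonal subsequence converges at every rational; compactness of the extended reals
  replaces a uniform bound. Since a rational lies between any two points, the limsup at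
  \<open>s\<close> is at most the liminf at any \<open>t < s\<close>, and
  \<open>countable_crossing\<close> leaves only countably many points of divergence.\<close>

lemma Helly_antimono:
  fixes f :: "nat \<Rightarrow> real \<Rightarrow> ereal"
  assumes "\<And>n. antimono (f n)"
  obtains r C where "strict_mono (r :: nat \<Rightarrow> nat)" and "countable C"
    and "\<And>t. t \<notin> C \<Longrightarrow> (\<lambda>n. f (r n) t) \<longlonglongrightarrow> liminf (\<lambda>n. f (r n) t)"
proof -
  define q :: "nat \<Rightarrow> real" where "q = from_nat_into \<rat>"
  have q: "range q = \<rat>"
    unfolding q_def using countable_rat by (intro range_from_nat_into) auto
  let ?P = "\<lambda>n s. convergent (\<lambda>k. f (s k) (q n))"
  interpret P: subseqs ?P
  proof
    fix n :: nat and s :: "nat \<Rightarrow> nat" assume "strict_mono s"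
    obtain l r where "strict_mono r" "((\<lambda>k. f (s k) (q n)) \<circ> r) \<longlonglongrightarrow> l"
      using compact_complete_linorder[of "\<lambda>k. f (s k) (q n)"] by blast
    then show "\<exists>r'. strict_mono r' \<and> ?P n (s \<circ> r')"
      by (auto simp: comp_def convergent_def)
  qed
  define d where "d = P.diagseq"
  have d: "strict_mono d" unfolding d_def by (rule P.subseq_diagseq)
  have conv: "?P n d" for n
  proof -
    have "?P n (d \<circ> (+) (Suc n))"
      unfolding d_def
    proof (rule P.diagseq_holds)
      fix r s n assume "strict_mono (r :: nat \<Rightarrow> nat)" and "?P n s"
      then show "?P n (s \<circ> r)"
        using convergent_subseq_convergent[of "\<lambda>k. f (s k) (q n)" r] by (simp add: comp_def)
    qed
    then obtain L where "(\<lambda>k. f (d (k + Suc n)) (q n)) \<longlonglongrightarrow> L"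
      by (auto simp: comp_def add.commute convergent_def)
    then have "(\<lambda>k. f (d k) (q n)) \<longlonglongrightarrow> L" by (rule LIMSEQ_offset)
    then show ?thesis by (auto simp: convergent_def)
  qed
  have cross: "limsup (\<lambda>n. f (d n) s) \<le> liminf (\<lambda>n. f (d n) t)" if ts: "t < s" for s t
  proof -
    obtain p where "p \<in> \<rat>" "t < p" "p < s" using Rats_dense_in_real[OF ts] by blast
    then obtain n where n: "t \<le> q n" "q n \<le> s" using q by (metis imageE less_imp_le)
    have "limsup (\<lambda>k. f (d k) s) \<le> limsup (\<lambda>k. f (d k) (q n))"
      using n antimonoD[OF assms] by (intro Limsup_mono) auto
    also have "\<dots> = liminf (\<lambda>k. f (d k) (q n))"
      using conv[of n] by (auto simp: convergent_def dest: lim_imp_Limsup[OF trivial_limit_sequentially] lim_imp_Liminf[OF trivial_limit_sequentially])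
    also have "\<dots> \<le> liminf (\<lambda>k. f (d k) t)"
      using n antimonoD[OF assms] by (intro Liminf_mono) auto
    finally show ?thesis .
  qed
  have "countable {t \<in> UNIV. liminf (\<lambda>n. f (d n) t) < limsup (\<lambda>n. f (d n) t)}"
    by (rule countable_crossing) (rule cross)
  then show ?thesis
  proof (rule that[OF d])
    fix t assume "t \<notin> {t \<in> UNIV. liminf (\<lambda>n. f (d n) t) < limsup (\<lambda>n. f (d n) t)}"
    then have "limsup (\<lambda>n. f (d n) t) = liminf (\<lambda>n. f (d n) t)"
      by (intro antisym Liminf_le_Limsup) auto
    then show "(\<lambda>n. f (d n) t) \<longlonglongrightarrow> liminf (\<lambda>n. f (d n) t)"
      by (intro Liminf_eq_Limsup) auto
  qed
qed

section \<open>Step functions and weak majorization\<close>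

text \<open>The Hardy--Littlewood--Polya theorem for a functional that does not grow when a vector
  is averaged with one of its transpositions. The induction is on the number of coordinates in which
  \<open>a\<close> and \<open>b\<close> differ: each transfer from a coordinate with surplus to a
  later one with deficit makes one of them agree. Without a deficit, \<open>mono\<close>
  applies.\<close>

lemma weak_majorization_le:
  fixes a b :: "nat \<Rightarrow> real" and p :: "(nat \<Rightarrow> real) \<Rightarrow> real"
  assumes mono: "\<And>a b. (\<And>i. i < n \<Longrightarrow> 0 \<le> a i \<and> a i \<le> b i) \<Longrightarrow> p a \<le> p b"
    and transfer: "\<And>b i k \<theta>. i < n \<Longrightarrow> k < n \<Longrightarrow> 0 \<le> \<theta> \<Longrightarrow> \<theta> \<le> 1 \<Longrightarrow>
      p (\<lambda>j. (1 - \<theta>) * b j + \<theta> * b (Transposition.transpose i k j)) \<le> p b"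
    and a_nonneg: "\<And>i. i < n \<Longrightarrow> 0 \<le> a i"
    and a_antimono: "\<And>i j. i \<le> j \<Longrightarrow> j < n \<Longrightarrow> a j \<le> a i"
    and partial: "\<And>j. j \<le> n \<Longrightarrow> sum a {..<j} \<le> sum b {..<j}"
  shows "p a \<le> p b"
  using partial
proof (induction "card {j. j < n \<and> a j \<noteq> b j}" arbitrary: b rule: less_induct)
  case less
  show ?case
  proof (cases "\<exists>k<n. b k < a k")
    case False
    then show ?thesis using a_nonneg by (intro mono) force
  next
    case True
    define k where "k = (LEAST k. k < n \<and> b k < a k)"
    have k: "k < n" "b k < a k" unfolding k_def using LeastI_ex[OF True] by auto
    have below: "a j \<le> b j" if "j < k" for j
      using not_less_Least[of j "\<lambda>k. k < n \<and> b k < a k"] that k(1) by (force simp: k_def[symmetric])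
    \<comment> \<open>Without a surplus before \<open>k\<close>, the deficit at \<open>k\<close>
      would violate \<open>partial\<close> for \<open>Suc k\<close>.\<close>
    have "\<exists>i<k. a i < b i"
    proof (rule ccontr)
      assume "\<not> (\<exists>i<k. a i < b i)"
      then have "sum b {..<k} \<le> sum a {..<k}" by (intro sum_mono) auto
      then have "sum b {..<Suc k} < sum a {..<Suc k}" using k by simp
      then show False using less.prems[of "Suc k"] k by simp
    qed
    then obtain i where i: "i < k" "a i < b i" by blast
    have "a k \<le> a i" using a_antimono i k by simp
    \<comment> \<open>The largest amount that can move from \<open>i\<close> to \<open>k\<close>
      without overshooting either target. As \<open>b k < a k \<le> a i < b i\<close>, it is at most
      \<open>b i - b k\<close>, so \<open>\<theta>\<close> is a legitimate weight.\<close>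
    define d where "d = min (b i - a i) (a k - b k)"
    define \<theta> where "\<theta> = d / (b i - b k)"
    define b' where "b' = (\<lambda>j. (1 - \<theta>) * b j + \<theta> * b (Transposition.transpose i k j))"
    have d: "0 < d" "d \<le> b i - a i" "d \<le> a k - b k" "d = b i - a i \<or> d = a k - b k"
      using i k by (auto simp: d_def)
    have \<theta>: "0 \<le> \<theta>" "\<theta> \<le> 1" "\<theta> * (b i - b k) = d"
      using d \<open>a k \<le> a i\<close> by (auto simp: \<theta>_def field_simps)
    have b'i: "b' i = b i - d" and b'k: "b' k = b k + d"
      using \<theta>(3) by (auto simp: b'_def algebra_simps)
    have b'j: "b' j = b j" if "j \<noteq> i" "j \<noteq> k" for j
      using that by (simp add: b'_def transpose_apply_other algebra_simps)
    have "p a \<le> p b'"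
    proof (rule less.hyps)
      have "{j. j < n \<and> a j \<noteq> b' j} \<subset> {j. j < n \<and> a j \<noteq> b j}"
      proof (rule psubsetI)
        show "{j. j < n \<and> a j \<noteq> b' j} \<subseteq> {j. j < n \<and> a j \<noteq> b j}"
        proof
          fix j assume "j \<in> {j. j < n \<and> a j \<noteq> b' j}"
          then show "j \<in> {j. j < n \<and> a j \<noteq> b j}"
            using b'j[of j] i k by (cases "j = i \<or> j = k") auto
        qed
        have "i \<in> {j. j < n \<and> a j \<noteq> b j}" "k \<in> {j. j < n \<and> a j \<noteq> b j}"
          using i k by auto
        moreover have "i \<notin> {j. j < n \<and> a j \<noteq> b' j} \<or> k \<notin> {j. j < n \<and> a j \<noteq> b' j}"
          using d(4) b'i b'k by auto
        ultimately show "{j. j < n \<and> a j \<noteq> b' j} \<noteq> {j. j < n \<and> a j \<noteq> b j}" by blast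
      qed
      then show "card {j. j < n \<and> a j \<noteq> b' j} < card {j. j < n \<and> a j \<noteq> b j}"
        by (intro psubset_card_mono) auto
    next
      fix j assume j: "j \<le> n"
      have b'_sum: "b' l = b l + (if l = i then - d else 0) + (if l = k then d else 0)" for l
        using b'i b'k b'j[of l] i by auto
      have sum_b': "sum b' {..<j} = sum b {..<j} + (if i < j then - d else 0) + (if k < j then d else 0)"
        unfolding b'_sum sum.distrib by simp
      show "sum a {..<j} \<le> sum b' {..<j}"
      proof (cases "i < j \<and> j \<le> k")
        case True
        \<comment> \<open>Only sums that contain \<open>i\<close> but not \<open>k\<close> decrease.
          All their terms \<open>b l - a l\<close> are nonnegative, since \<open>k\<close> is the
          first deficit, and the term at \<open>i\<close> alone covers the loss
          \<open>d\<close>.\<close>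
        have "sum (\<lambda>l. b l - a l) {i} \<le> sum (\<lambda>l. b l - a l) {..<j}"
          using True below by (intro sum_mono2) auto
        then show ?thesis using True d sum_b' by (simp add: sum_subtractf)
      next
        case False
        then show ?thesis using less.prems[OF j] i by (auto simp: sum_b' d(1) less_imp_le)
      qed
    qed
    also have "p b' \<le> p b" unfolding b'_def using i k \<theta> by (intro transfer) auto
    finally show ?thesis .
  qed
qed

text \<open>Partial sums of a decreasing sequence are concave, so between \<open>p\<close> and
  \<open>q\<close> they stay nonnegative if they are so at both ends. A negative term before
  \<open>J\<close> makes all later ones nonpositive, and the sum at \<open>J\<close> is then at
  least that at \<open>q\<close>.\<close>

lemma partial_sums_nonneg_between:
  fixes d :: "nat \<Rightarrow> real"
  assumes d: "\<And>i j. p \<le> i \<Longrightarrow> i \<le> j \<Longrightarrow> j < q \<Longrightarrow> d j \<le> d i"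
    and p: "0 \<le> sum d {..<p}" and q: "0 \<le> sum d {..<q}" and J: "p \<le> J" "J \<le> q"
  shows "0 \<le> sum d {..<J}"
proof (cases "\<exists>i\<in>{p..<J}. d i < 0")
  case False
  have "sum d {..<J} = sum d {..<p} + sum d {p..<J}"
    using J by (metis atLeast0LessThan sum.atLeastLessThan_concat zero_le)
  moreover have "0 \<le> sum d {p..<J}" using False by (intro sum_nonneg) (meson not_le)
  ultimately show ?thesis using p by simp
next
  case True
  then obtain i where i: "p \<le> i" "i < J" "d i < 0" by auto
  have "sum d {..<q} = sum d {..<J} + sum d {J..<q}"
    using J by (metis atLeast0LessThan sum.atLeastLessThan_concat zero_le)
  moreover have "sum d {J..<q} \<le> 0"
  proof (rule sum_nonpos)
    fix j assume "j \<in> {J..<q}"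
    then show "d j \<le> 0" using d[of i j] i by simp
  qed
  ultimately show ?thesis using q by simp
qed

section \<open>Step functions on uniform grids\<close>

definition step_fun :: "nat \<Rightarrow> (nat \<Rightarrow> real) \<Rightarrow> real \<Rightarrow> ereal" where
  "step_fun n a = (\<lambda>s. ereal (a (nat \<lfloor>real n * s\<rfloor>)))"

lemma step_fun_borel [measurable]: "step_fun n a \<in> borel_measurable borel"
proof -
  have "(\<lambda>s::real. \<lfloor>real n * s\<rfloor>) \<in> borel \<rightarrow>\<^sub>M count_space UNIV" by measurable
  then have "(\<lambda>s. ereal (a (nat \<lfloor>real n * s\<rfloor>))) \<in> borel_measurable borel"
    by (rule measurable_compose) simp
  then show ?thesis by (simp add: step_fun_def)
qed

lemma step_fun_L0: "step_fun n a \<in> L0"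
  unfolding L0_def by (intro measurable_unit_leb step_fun_borel)

lemma nat_floor_mult_eq_iff:
  assumes "0 < n" "0 \<le> s"
  shows "nat \<lfloor>real n * s\<rfloor> = j \<longleftrightarrow> s \<in> {real j / real n..<real (Suc j) / real n}"
proof -
  have "nat \<lfloor>real n * s\<rfloor> = j \<longleftrightarrow> \<lfloor>real n * s\<rfloor> = int j"
    using assms by (auto simp: nat_eq_iff)
  also have "\<dots> \<longleftrightarrow> real j \<le> real n * s \<and> real n * s < real j + 1" by (simp add: floor_eq_iff)
  also have "\<dots> \<longleftrightarrow> s \<in> {real j / real n..<real (Suc j) / real n}"
    using assms by (auto simp: field_simps)
  finally show ?thesis .
qed

lemma nat_floor_mult_less:
  assumes "0 < n" "0 \<le> s" "s < 1"
  shows "nat \<lfloor>real n * s\<rfloor> < n"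
proof -
  have "real n * s < real n" using assms by simp
  then show ?thesis using assms by (simp add: nat_less_iff floor_less_iff)
qed

lemma dist_fun_step_fun:
  assumes n: "0 < n"
  shows "dist_fun (step_fun n a) l = real (card {j. j < n \<and> l < \<bar>a j\<bar>}) / real n"
proof -
  interpret finite_measure unit_leb by (rule finite_measure_unit_leb)
  define S where "S = {j. j < n \<and> l < \<bar>a j\<bar>}"
  define B where "B j = {real j / real n..<real (Suc j) / real n}" for j
  have B: "s \<in> B j \<longleftrightarrow> 0 \<le> s \<and> nat \<lfloor>real n * s\<rfloor> = j" for s j
  proof (cases "0 \<le> s")
    case True then show ?thesis using nat_floor_mult_eq_iff[OF n True, of j] by (simp add: B_def)
  next
    case False
    then show ?thesis using order_trans[of 0 "real j / real n" s] by (auto simp: B_def)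
  qed
  have sub: "B j \<subseteq> {0..<1}" if "j \<in> S" for j
  proof
    fix s assume s: "s \<in> B j"
    then have "s < real (Suc j) / real n" "0 \<le> s" using B by (auto simp: B_def)
    moreover have "real (Suc j) / real n \<le> 1" using that n by (simp add: S_def)
    ultimately show "s \<in> {0..<1}" by simp
  qed
  have eq: "{s \<in> {0..<1}. \<bar>step_fun n a s\<bar> > ereal l} = (\<Union>j\<in>S. B j)"
  proof (intro equalityI subsetI)
    fix s assume "s \<in> {s \<in> {0..<1}. \<bar>step_fun n a s\<bar> > ereal l}"
    then show "s \<in> (\<Union>j\<in>S. B j)"
      using nat_floor_mult_less[OF n, of s] by (auto simp: B S_def step_fun_def)
  next
    fix s assume "s \<in> (\<Union>j\<in>S. B j)"
    then obtain j where "j \<in> S" "s \<in> B j" by auto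
    then show "s \<in> {s \<in> {0..<1}. \<bar>step_fun n a s\<bar> > ereal l}"
      using sub[of j] by (auto simp: B S_def step_fun_def)
  qed
  have "measure unit_leb (\<Union>j\<in>S. B j) = (\<Sum>j\<in>S. measure unit_leb (B j))"
  proof (rule finite_measure_finite_Union)
    show "finite S" by (simp add: S_def)
    show "B ` S \<subseteq> sets unit_leb"
      using sub by (auto simp: sets_restrict_space_iff B_def)
    show "disjoint_family_on B S" by (auto simp: disjoint_family_on_def B)
  qed
  also have "\<dots> = (\<Sum>j\<in>S. 1 / real n)"
  proof (rule sum.cong)
    fix j assume "j \<in> S"
    have "real j / real n \<le> real (Suc j) / real n" by (simp add: divide_right_mono)
    then have "measure unit_leb (B j) = real (Suc j) / real n - real j / real n"
      using sub[OF \<open>j \<in> S\<close>] by (subst measure_unit_leb) (auto simp: B_def)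
    also have "\<dots> = 1 / real n" by (simp add: diff_divide_distrib[symmetric])
    finally show "measure unit_leb (B j) = 1 / real n" .
  qed simp
  also have "\<dots> = real (card S) / real n" by simp
  finally show ?thesis unfolding dist_fun_def eq by (simp add: S_def)
qed

text \<open>Only the number of coefficients above a level enters the distribution function, and a
  transposition permutes the indices.\<close>

lemma dist_fun_step_fun_transpose:
  assumes "i < n" "k < n"
  shows "dist_fun (step_fun n (\<lambda>j. a (Transposition.transpose i k j))) = dist_fun (step_fun n a)"
proof
  fix l
  let ?T = "Transposition.transpose i k"
  have "bij_betw ?T {j. j < n \<and> l < \<bar>a (?T j)\<bar>} {j. j < n \<and> l < \<bar>a j\<bar>}"
  proof (rule bij_betw_byWitness[where f' = ?T])
    have "?T j < n" if "j < n" for j using that assms by (auto simp: Transposition.transpose_def)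
    then show "?T ` {j. j < n \<and> l < \<bar>a (?T j)\<bar>} \<subseteq> {j. j < n \<and> l < \<bar>a j\<bar>}"
      and "?T ` {j. j < n \<and> l < \<bar>a j\<bar>} \<subseteq> {j. j < n \<and> l < \<bar>a (?T j)\<bar>}" by auto
  qed auto
  then have "card {j. j < n \<and> l < \<bar>a (?T j)\<bar>} = card {j. j < n \<and> l < \<bar>a j\<bar>}"
    by (rule bij_betw_same_card)
  then show "dist_fun (step_fun n (\<lambda>j. a (?T j))) l = dist_fun (step_fun n a) l"
    using assms by (simp add: dist_fun_step_fun)
qed

text \<open>Sampling at the right end of each dyadic cell bounds a decreasing function from below
  and avoids the argument \<open>0\<close>, where it may be infinite.\<close>

definition lower_step :: "(real \<Rightarrow> ereal) \<Rightarrow> nat \<Rightarrow> real \<Rightarrow> ereal" where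
  "lower_step f k = step_fun (2 ^ k) (\<lambda>j. real_of_ereal (f (real (Suc j) / 2 ^ k)))"

text \<open>Finiteness is required at positive arguments only, so that rearrangements of unbounded
  functions are covered.\<close>

locale decreasing_fun =
  fixes f :: "real \<Rightarrow> ereal"
  assumes antimono: "antimono f" and nonneg: "0 \<le> f s" and finite: "0 < s \<Longrightarrow> f s \<noteq> \<infinity>"
begin

lemma lower_step_eq:
  assumes "0 \<le> s"
  shows "lower_step f k s = f ((real_of_int \<lfloor>2 ^ k * s\<rfloor> + 1) / 2 ^ k)"
proof -
  have "real (nat \<lfloor>2 ^ k * s\<rfloor>) = real_of_int \<lfloor>2 ^ k * s\<rfloor>" using assms by simp
  moreover have "0 < (real_of_int \<lfloor>2 ^ k * s\<rfloor> + 1) / 2 ^ k"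
    using assms by (intro divide_pos_pos add_nonneg_pos) auto
  ultimately show ?thesis
    using finite nonneg by (auto simp: lower_step_def step_fun_def add.commute ereal_real')
qed

lemma lower_step_le:
  assumes "0 \<le> s"
  shows "lower_step f k s \<le> f s"
proof -
  have "s \<le> (real_of_int \<lfloor>2 ^ k * s\<rfloor> + 1) / 2 ^ k"
    using floor_correct[of "2 ^ k * s"] by (simp add: field_simps)
  then show ?thesis unfolding lower_step_eq[OF assms] by (rule antimonoD[OF antimono])
qed

lemma lower_step_nonneg: "0 \<le> lower_step f k s"
  using nonneg by (simp add: lower_step_def step_fun_def real_of_ereal_pos)

text \<open>Halving the cells never moves the right end of the cell of \<open>s\<close> to the
  right, so the sampled value can only grow.\<close>

lemma lower_step_incseq:
  assumes "0 \<le> s"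
  shows "incseq (\<lambda>k. lower_step f k s)"
proof (rule incseq_SucI)
  fix k
  have "2 ^ k * s < real_of_int \<lfloor>2 ^ k * s\<rfloor> + 1" by linarith
  then have "2 ^ Suc k * s < 2 * (real_of_int \<lfloor>2 ^ k * s\<rfloor> + 1)"
    by (simp only: power_Suc mult.assoc mult_less_cancel_left_pos zero_less_numeral)
  then have "\<lfloor>2 ^ Suc k * s\<rfloor> < 2 * (\<lfloor>2 ^ k * s\<rfloor> + 1)"
    by (simp add: floor_less_iff)
  then have "real_of_int (\<lfloor>2 ^ Suc k * s\<rfloor> + 1) \<le> real_of_int (2 * (\<lfloor>2 ^ k * s\<rfloor> + 1))"
    by (subst of_int_le_iff) (rule zless_imp_add1_zle)
  then have "real_of_int \<lfloor>2 ^ Suc k * s\<rfloor> + 1 \<le> 2 * (real_of_int \<lfloor>2 ^ k * s\<rfloor> + 1)"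
    by (simp only: of_int_add of_int_mult of_int_1 of_int_numeral)
  then have "(real_of_int \<lfloor>2 ^ Suc k * s\<rfloor> + 1) / 2 ^ Suc k \<le> 2 * (real_of_int \<lfloor>2 ^ k * s\<rfloor> + 1) / 2 ^ Suc k"
    by (rule divide_right_mono) simp
  also have "\<dots> = (real_of_int \<lfloor>2 ^ k * s\<rfloor> + 1) / 2 ^ k" by (simp del: distrib_left_numeral)
  finally have "(real_of_int \<lfloor>2 ^ Suc k * s\<rfloor> + 1) / 2 ^ Suc k \<le> (real_of_int \<lfloor>2 ^ k * s\<rfloor> + 1) / 2 ^ k" .
  then show "lower_step f k s \<le> lower_step f (Suc k) s"
    unfolding lower_step_eq[OF assms] by (rule antimonoD[OF antimono])
qed

text \<open>Once the mesh is below \<open>t - s\<close>, the right end of the cell of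
  \<open>s\<close> lies before \<open>t\<close>.\<close>

lemma lower_step_ge:
  assumes "0 \<le> s" "s < t"
  obtains k where "f t \<le> lower_step f k s"
proof -
  obtain k where k: "inverse (2 ^ k) < t - s"
    using real_arch_pow_inv[of "t - s" "1/2"] assms by (auto simp: power_divide inverse_eq_divide)
  have "(real_of_int \<lfloor>2 ^ k * s\<rfloor> + 1) / 2 ^ k \<le> (2 ^ k * s + 1) / 2 ^ k"
    by (intro divide_right_mono) auto
  also have "\<dots> = s + inverse (2 ^ k)" by (simp add: field_simps)
  also have "\<dots> \<le> t" using k by simp
  finally have "f t \<le> lower_step f k s"
    unfolding lower_step_eq[OF assms(1)] by (rule antimonoD[OF antimono])
  then show ?thesis by (rule that)
qed

text \<open>The supremum of the approximations at \<open>t\<close> dominates all values of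
  \<open>f\<close> to the right of \<open>t\<close>, so by \<open>countable_crossing\<close> it
  falls short of \<open>f\<close> at countably many points only.\<close>

lemma lower_step_tendsto:
  obtains C where "countable C"
    and "\<And>s. 0 \<le> s \<Longrightarrow> s \<notin> C \<Longrightarrow> (\<lambda>k. lower_step f k s) \<longlonglongrightarrow> f s"
proof -
  define g where "g s = (SUP k. lower_step f k s)" for s
  have "countable {s \<in> {0..}. g s < f s}"
  proof (rule countable_crossing)
    fix s t :: real assume "t < s" "t \<in> {0..}" "s \<in> {0..}"
    then obtain k where "f s \<le> lower_step f k t" using lower_step_ge by auto
    then show "f s \<le> g t" unfolding g_def by (meson SUP_upper2 UNIV_I)
  qed
  then show ?thesis
  proof (rule that)
    fix s :: real assume s: "0 \<le> s" "s \<notin> {s \<in> {0..}. g s < f s}"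
    have "g s \<le> f s" unfolding g_def by (intro SUP_least lower_step_le s)
    with s have "g s = f s" by auto
    then show "(\<lambda>k. lower_step f k s) \<longlonglongrightarrow> f s"
      using LIMSEQ_SUP[OF lower_step_incseq[OF s(1)]] by (simp add: g_def)
  qed
qed

end

text \<open>For a rearrangement this is \<open>t\<close> times the maximal function. It is defined
  for arbitrary functions so that step functions and cut-off functions can be compared
  directly.\<close>

definition head_integral :: "(real \<Rightarrow> ereal) \<Rightarrow> real \<Rightarrow> ennreal" where
  "head_integral f t = (\<integral>\<^sup>+s\<in>{0<..<t}. e2ennreal (f s) \<partial>lborel)"

lemma head_integral_mono:
  assumes "\<And>s. 0 < s \<Longrightarrow> s < t \<Longrightarrow> f s \<le> g s"
  shows "head_integral f t \<le> head_integral g t"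
  unfolding head_integral_def using assms
  by (intro nn_integral_mono) (auto simp: indicator_def intro!: e2ennreal_mono)

lemma submajorized_iff: "submajorized x y \<longleftrightarrow> (\<forall>t>0. head_integral (decr_rearr x) t \<le> head_integral (decr_rearr y) t)"
proof -
  have "a / ennreal t \<le> b / ennreal t \<longleftrightarrow> a \<le> b" if "0 < t" for a b t
  proof
    assume "a / ennreal t \<le> b / ennreal t"
    then have "a / ennreal t * ennreal t \<le> b / ennreal t * ennreal t" by (rule mult_right_mono) simp
    then show "a \<le> b" using that by (simp add: ennreal_divide_times ennreal_divide_self ennreal_times_divide[symmetric])
  qed (rule divide_right_mono_ennreal)
  then show ?thesis by (simp add: submajorized_def maximal_fun_def head_integral_def)
qed

lemma head_integral_step_fun:
  assumes n: "0 < n" and a: "\<And>j. j < J \<Longrightarrow> 0 \<le> a j"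
  shows "head_integral (step_fun n a) (real J / real n) = ennreal (sum a {..<J} / real n)"
proof -
  define B where "B j = {real j / real n..<real (Suc j) / real n}" for j
  have "head_integral (step_fun n a) (real J / real n)
      = (\<integral>\<^sup>+s. (\<Sum>j<J. ennreal (a j) * indicator (B j) s) \<partial>lborel)"
    unfolding head_integral_def
  proof (rule nn_integral_cong_AE)
    \<comment> \<open>The first cell contains \<open>0\<close>, the interval of integration does
      not.\<close>
    have "AE s in lborel. s \<noteq> (0::real)" by (rule AE_lborel_singleton)
    then show "AE s in lborel. e2ennreal (step_fun n a s) * indicator {0<..<real J / real n} s
        = (\<Sum>j<J. ennreal (a j) * indicator (B j) s)"
    proof eventually_elim
      fix s :: real assume "s \<noteq> 0"
      show "e2ennreal (step_fun n a s) * indicator {0<..<real J / real n} s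
        = (\<Sum>j<J. ennreal (a j) * indicator (B j) s)"
      proof (cases "0 < s")
        case False
        have "s \<notin> B j" for j
          using False \<open>s \<noteq> 0\<close> order_trans[of 0 "real j / real n" s] by (auto simp: B_def)
        then show ?thesis using False by simp
      next
        case True
        define m where "m = nat \<lfloor>real n * s\<rfloor>"
        have B: "s \<in> B j \<longleftrightarrow> j = m" for j
          using nat_floor_mult_eq_iff[OF n, of s j] True by (auto simp: B_def m_def)
        have "s < real J / real n \<longleftrightarrow> \<lfloor>real n * s\<rfloor> < int J"
          using n by (simp add: floor_less_iff field_simps)
        also have "\<dots> \<longleftrightarrow> m < J" using True n by (simp add: m_def nat_less_iff)
        finally have iff: "s < real J / real n \<longleftrightarrow> m < J" .
        have "(\<Sum>j<J. ennreal (a j) * indicator (B j) s) = (\<Sum>j<J. if j = m then ennreal (a m) else 0)"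
          by (intro sum.cong) (auto simp: B)
        also have "\<dots> = (if m < J then ennreal (a m) else 0)" by simp
        also have "\<dots> = e2ennreal (step_fun n a s) * indicator {0<..<real J / real n} s"
          using True iff by (auto simp: step_fun_def m_def[symmetric] ennreal.rep_eq e2ennreal_ereal)
        finally show ?thesis by simp
      qed
    qed
  qed
  also have "\<dots> = (\<Sum>j<J. ennreal (a j) * emeasure lborel (B j))"
    by (subst nn_integral_sum) (auto simp: B_def nn_integral_cmult_indicator)
  also have "\<dots> = (\<Sum>j<J. ennreal (a j / real n))"
  proof (rule sum.cong)
    fix j assume "j \<in> {..<J}"
    have "real j / real n \<le> real (Suc j) / real n" by (simp add: divide_right_mono)
    then have "emeasure lborel (B j) = ennreal (real (Suc j) / real n - real j / real n)"
      by (simp add: B_def)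
    also have "real (Suc j) / real n - real j / real n = 1 / real n"
      by (simp add: diff_divide_distrib[symmetric])
    finally show "ennreal (a j) * emeasure lborel (B j) = ennreal (a j / real n)"
      using a \<open>j \<in> {..<J}\<close> by (simp add: ennreal_mult[symmetric])
  qed simp
  also have "\<dots> = ennreal (\<Sum>j<J. a j / real n)"
    using a by (intro sum_ennreal) auto
  also have "(\<Sum>j<J. a j / real n) = sum a {..<J} / real n"
    by (rule sum_divide_distrib[symmetric])
  finally show ?thesis .
qed

text \<open>Fatou's lemma bounds the integral of \<open>f\<close> by the liminf of those of the
  approximations, and \<open>c\<close> lies strictly below it. This also covers an infinite
  integral.\<close>

lemma (in decreasing_fun) head_integral_lower_step:
  assumes "c < head_integral f t"
  shows "eventually (\<lambda>k. c < head_integral (lower_step f k) t) sequentially"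
proof -
  have [measurable]: "lower_step f k \<in> borel_measurable borel" for k
    unfolding lower_step_def by simp
  obtain C where C: "countable C" "\<And>s. 0 \<le> s \<Longrightarrow> s \<notin> C \<Longrightarrow> (\<lambda>k. lower_step f k s) \<longlonglongrightarrow> f s"
    using lower_step_tendsto by blast
  have "AE s in lborel. s \<notin> C"
    using C(1) by (intro AE_not_in countable_imp_null_set_lborel)
  then have "AE s in lborel. e2ennreal (f s) * indicator {0<..<t} s
      = liminf (\<lambda>k. e2ennreal (lower_step f k s) * indicator {0<..<t} s)"
  proof eventually_elim
    fix s assume s: "s \<notin> C"
    show "e2ennreal (f s) * indicator {0<..<t} s
      = liminf (\<lambda>k. e2ennreal (lower_step f k s) * indicator {0<..<t} s)"
    proof (cases "s \<in> {0<..<t}")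
      case True
      then have "(\<lambda>k. e2ennreal (lower_step f k s)) \<longlonglongrightarrow> e2ennreal (f s)"
        using C(2)[of s] s by (intro tendsto_e2ennrealI) auto
      then show ?thesis using True by (simp add: lim_imp_Liminf)
    next
      case False then show ?thesis by (simp add: Liminf_const)
    qed
  qed
  then have "head_integral f t = (\<integral>\<^sup>+s. liminf (\<lambda>k. e2ennreal (lower_step f k s) * indicator {0<..<t} s) \<partial>lborel)"
    unfolding head_integral_def by (rule nn_integral_cong_AE)
  also have "\<dots> \<le> liminf (\<lambda>k. head_integral (lower_step f k) t)"
    unfolding head_integral_def by (rule nn_integral_liminf) measurable
  finally show ?thesis using assms by (simp add: le_Liminf_iff)
qed

section \<open>Monotonicity of the norm under submajorization\<close>

context banach_function_space
begin

lemma abs_mem: "g \<in> E \<Longrightarrow> (\<lambda>s. \<bar>g s\<bar>) \<in> E"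
  and norm_abs: "g \<in> E \<Longrightarrow> N (\<lambda>s. \<bar>g s\<bar>) = N g"
proof -
  assume g: "g \<in> E"
  then have [measurable]: "g \<in> borel_measurable unit_leb" using subset_L0 by (auto simp: L0_def)
  have "(\<lambda>s. \<bar>g s\<bar>) \<in> L0" unfolding L0_def by measurable
  from ideal[OF this g] have *: "(\<lambda>s. \<bar>g s\<bar>) \<in> E" "N (\<lambda>s. \<bar>g s\<bar>) \<le> N g" by auto
  moreover have "N g \<le> N (\<lambda>s. \<bar>g s\<bar>)"
    using g subset_L0 by (intro ideal[THEN conjunct2] *) auto
  ultimately show "(\<lambda>s. \<bar>g s\<bar>) \<in> E" "N (\<lambda>s. \<bar>g s\<bar>) = N g" by auto
qed

lemma norm_mono:
  assumes "f \<in> L0" "g \<in> E" "AE s in unit_leb. \<bar>f s\<bar> \<le> \<bar>g s\<bar>"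
  shows "f \<in> E" "N f \<le> N g"
  using ideal[OF assms] by auto

lemma norm_cong_AE:
  assumes "f \<in> L0" "g \<in> E" "AE s in unit_leb. f s = g s"
  shows "f \<in> E" "N f = N g"
proof -
  show f: "f \<in> E" using assms(3) by (intro norm_mono(1)[OF assms(1,2)]) (auto elim!: eventually_mono)
  show "N f = N g"
    using assms f subset_L0 by (intro antisym norm_mono(2)) (auto elim!: eventually_mono)
qed

lemma norm_le_add:
  assumes "f \<in> L0" "g \<in> E" "h \<in> E" "AE s in unit_leb. \<bar>f s\<bar> \<le> \<bar>g s\<bar> + \<bar>h s\<bar>"
  shows "f \<in> E" "N f \<le> N g + N h"
proof -
  have E: "(\<lambda>s. \<bar>g s\<bar> + \<bar>h s\<bar>) \<in> E" using assms by (intro add_mem abs_mem)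
  have le: "AE s in unit_leb. \<bar>f s\<bar> \<le> \<bar>\<bar>g s\<bar> + \<bar>h s\<bar>\<bar>" using assms(4) by simp
  show "f \<in> E" by (rule norm_mono(1)[OF assms(1) E le])
  have "N f \<le> N (\<lambda>s. \<bar>g s\<bar> + \<bar>h s\<bar>)" by (rule norm_mono(2)[OF assms(1) E le])
  also have "\<dots> \<le> N (\<lambda>s. \<bar>g s\<bar>) + N (\<lambda>s. \<bar>h s\<bar>)" using assms by (intro norm_triangle abs_mem)
  finally show "N f \<le> N g + N h" using assms by (simp add: norm_abs)
qed

end

section \<open>Bounded functions and step functions in a symmetric space\<close>

context symmetric_space
begin

lemma decr_rearr_mem: "x \<in> E \<Longrightarrow> decr_rearr x \<in> E"
  and norm_decr_rearr: "x \<in> E \<Longrightarrow> N (decr_rearr x) = N x"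
  using symmetric[OF decr_rearr_L0 _ dist_fun_decr_rearr] subset_L0 by auto

text \<open>Adding the rearrangement of a strictly positive element to its reflection at \<open>1/2\<close>
  gives an element that is bounded away from zero.\<close>

lemma one_mem: "(\<lambda>s. 1) \<in> E"
proof -
  obtain w where w: "w \<in> E" "AE s in unit_leb. 0 < w s" using strictly_positive by blast
  then have wL: "w \<in> L0" using subset_L0 by auto
  define g where "g s = decr_rearr w s + decr_rearr w (1 - s)" for s
  have [measurable]: "decr_rearr w \<in> borel_measurable borel"
    by (intro borel_measurable_antimono antimono_decr_rearr)
  have "(\<lambda>s. decr_rearr w (1 - s)) \<in> L0"
    unfolding L0_def by (intro measurable_unit_leb) measurable
  then have "(\<lambda>s. decr_rearr w (1 - s)) \<in> E"
    using symmetric[OF _ w(1) dist_fun_reflect_decr_rearr[OF wL]] by simp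
  then have g: "g \<in> E" unfolding g_def using w by (intro add_mem decr_rearr_mem)
  have "dist_fun w 0 = 1"
  proof -
    interpret finite_measure unit_leb by (rule finite_measure_unit_leb)
    have "measure unit_leb {s \<in> {0..<1}. \<bar>w s\<bar> > ereal 0} = measure unit_leb {0..<1}"
      by (rule finite_measure_eq_AE)
        (use w(2) sets_unit_leb_level[OF wL] in \<open>auto elim!: eventually_mono simp: zero_ereal_def[symmetric]\<close>)
    then show ?thesis by (simp add: dist_fun_def measure_unit_leb)
  qed
  then have "0 < decr_rearr w (1/2)" using less_decr_rearr_iff[OF wL, of 0 "1/2"] by (simp add: zero_ereal_def)
  then obtain c where c: "0 < ereal c" "ereal c < decr_rearr w (1/2)" using ereal_dense2 by blast
  have "ereal c \<le> g s" for s
  proof (cases "s \<le> 1/2")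
    case True
    have "ereal c \<le> decr_rearr w s"
      using c(2) antimonoD[OF antimono_decr_rearr True, of w] by simp
    also have "\<dots> \<le> g s" using decr_rearr_nonneg by (simp add: g_def add_increasing2)
    finally show ?thesis .
  next
    case False
    have "ereal c \<le> decr_rearr w (1 - s)"
      using c(2) antimonoD[OF antimono_decr_rearr, of "1 - s" "1/2" w] False by simp
    also have "\<dots> \<le> g s" using decr_rearr_nonneg by (simp add: g_def add_increasing)
    finally show ?thesis .
  qed
  moreover have "0 \<le> g s" for s by (simp add: g_def decr_rearr_nonneg)
  ultimately have "\<bar>ereal c\<bar> \<le> \<bar>g s\<bar>" for s using c(1) by simp
  then have "(\<lambda>s. ereal c) \<in> E"
    by (intro norm_mono(1)[OF _ g]) (auto simp: L0_def)
  from scale_mem[OF this, of "1 / c"] c show ?thesis by (simp add: one_ereal_def)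
qed

definition norm_one :: real where "norm_one = N (\<lambda>s. 1)"

lemma const_mem: "(\<lambda>s. ereal c) \<in> E"
  and norm_const: "N (\<lambda>s. ereal c) = \<bar>c\<bar> * norm_one"
  using scale_mem[OF one_mem, of c] norm_scale[OF one_mem, of c] by (simp_all add: norm_one_def)

lemma bounded_mem:
  assumes "f \<in> L0" "AE s in unit_leb. \<bar>f s\<bar> \<le> ereal c"
  shows "f \<in> E"
  by (rule norm_mono(1)[OF assms(1) const_mem[of c]]) (use assms(2) in \<open>auto elim!: eventually_mono intro: order_trans\<close>)

lemma step_fun_mem: "step_fun n a \<in> E"
proof (cases "n = 0")
  case True
  then show ?thesis using const_mem[of "a 0"] by (simp add: step_fun_def)
next
  case False
  have "\<bar>step_fun n a s\<bar> \<le> ereal (\<Sum>j<n. \<bar>a j\<bar>)" if "0 < s" "s < 1" for s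
    using nat_floor_mult_less[of n s] that False
    by (auto simp: step_fun_def intro!: member_le_sum[of _ "{..<n}" "\<lambda>j. \<bar>a j\<bar>"])
  then show ?thesis by (intro bounded_mem[OF step_fun_L0] AE_unit_lebI_all)
qed

lemma norm_step_fun_mono:
  assumes "0 < n" "\<And>j. j < n \<Longrightarrow> 0 \<le> a j \<and> a j \<le> b j"
  shows "N (step_fun n a) \<le> N (step_fun n b)"
proof (rule norm_mono(2)[OF step_fun_L0 step_fun_mem], rule AE_unit_lebI_all)
  fix s :: real assume "0 < s" "s < 1"
  then have "nat \<lfloor>real n * s\<rfloor> < n" using assms(1) by (intro nat_floor_mult_less) auto
  from assms(2)[OF this] show "\<bar>step_fun n a s\<bar> \<le> \<bar>step_fun n b s\<bar>" by (simp add: step_fun_def)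
qed

text \<open>Linear operations on coefficients pass to step functions, so the triangle inequality
  applies; interchanging two coefficients preserves the distribution and hence the norm.\<close>

lemma norm_step_fun_transfer:
  assumes "i < n" "k < n" "0 \<le> \<theta>" "\<theta> \<le> 1"
  shows "N (step_fun n (\<lambda>j. (1 - \<theta>) * b j + \<theta> * b (Transposition.transpose i k j))) \<le> N (step_fun n b)"
proof -
  let ?b = "\<lambda>j. b (Transposition.transpose i k j)"
  have "N (step_fun n (\<lambda>j. (1 - \<theta>) * b j + \<theta> * ?b j))
      = N (\<lambda>s. ereal (1 - \<theta>) * step_fun n b s + ereal \<theta> * step_fun n ?b s)"
    by (simp add: step_fun_def)
  also have "\<dots> \<le> N (\<lambda>s. ereal (1 - \<theta>) * step_fun n b s) + N (\<lambda>s. ereal \<theta> * step_fun n ?b s)"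
    by (intro norm_triangle scale_mem step_fun_mem)
  also have "\<dots> = (1 - \<theta>) * N (step_fun n b) + \<theta> * N (step_fun n ?b)"
    using assms by (simp add: norm_scale step_fun_mem)
  also have "N (step_fun n ?b) = N (step_fun n b)"
    using symmetric[OF step_fun_L0 step_fun_mem dist_fun_step_fun_transpose[OF assms(1,2)]] by blast
  finally show ?thesis by (simp add: algebra_simps)
qed

text \<open>An infinite value at some \<open>s > 0\<close> would spread to all points before
  \<open>s\<close>, a set of positive measure, against \<open>finite_ae\<close>.\<close>

lemma decreasing_fun_mem:
  assumes "antimono f" "\<And>s. 0 \<le> f s" "f \<in> E"
  shows "decreasing_fun f"
proof
  fix s :: real assume s: "0 < s"
  show "f s \<noteq> \<infinity>"
  proof
    assume inf: "f s = \<infinity>"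
    interpret finite_measure unit_leb by (rule finite_measure_unit_leb)
    define t where "t = min s 1"
    have "AE r in unit_leb. r \<notin> {0..<t}"
      using finite_ae[OF assms(3)]
    proof eventually_elim
      fix r assume "\<bar>f r\<bar> \<noteq> \<infinity>"
      then have "\<not> r \<le> s" using antimonoD[OF assms(1), of r s] inf by auto
      then show "r \<notin> {0..<t}" by (auto simp: t_def)
    qed
    then have "measure unit_leb {0..<t} = measure unit_leb {}"
      by (intro finite_measure_eq_AE) (auto simp: sets_restrict_space_iff t_def elim!: eventually_mono)
    moreover have "measure unit_leb {0..<t} = t"
      using s by (subst measure_unit_leb) (auto simp: t_def)
    ultimately show False using s by (simp add: t_def)
  qed
qed (use assms in auto)

end

section \<open>Comparison of norms from comparison of head integrals\<close>

locale fatou_symmetric_space = symmetric_space +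
  assumes fatou: "fatou_property E N"
begin

lemma fatouD:
  assumes "\<And>n. X n \<in> E" "\<And>n. AE s in unit_leb. 0 \<le> X n s" "x \<in> L0" "\<And>n. N (X n) \<le> c"
    and "AE s in unit_leb. incseq (\<lambda>n. X n s) \<and> (\<lambda>n. X n s) \<longlonglongrightarrow> x s"
  shows "x \<in> E" "incseq (\<lambda>n. N (X n))" "(\<lambda>n. N (X n)) \<longlonglongrightarrow> N x"
proof -
  have "bdd_above (range (\<lambda>n. N (X n)))" using assms(4) by (intro bdd_aboveI2)
  then have "x \<in> E \<and> incseq (\<lambda>n. N (X n)) \<and> (\<lambda>n. N (X n)) \<longlonglongrightarrow> N x"
    using fatou[unfolded fatou_property_def, rule_format, of X x] assms by blast
  then show "x \<in> E" "incseq (\<lambda>n. N (X n))" "(\<lambda>n. N (X n)) \<longlonglongrightarrow> N x" by auto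
qed

lemma lower_step_mem: "lower_step f k \<in> E"
  unfolding lower_step_def by (rule step_fun_mem)

lemma norm_lower_step:
  assumes "decreasing_fun f" "f \<in> E"
  shows "N (lower_step f k) \<le> N f" "(\<lambda>k. N (lower_step f k)) \<longlonglongrightarrow> N f"
proof -
  interpret f: decreasing_fun f by fact
  show le: "N (lower_step f k) \<le> N f" for k
    using lower_step_mem subset_L0 f.lower_step_nonneg f.lower_step_le f.nonneg assms(2)
    by (intro norm_mono(2) AE_unit_lebI_all) auto
  obtain C where C: "countable C" "\<And>s. 0 \<le> s \<Longrightarrow> s \<notin> C \<Longrightarrow> (\<lambda>k. lower_step f k s) \<longlonglongrightarrow> f s"
    using f.lower_step_tendsto by blast
  show "(\<lambda>k. N (lower_step f k)) \<longlonglongrightarrow> N f"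
  proof (rule fatouD(3)[OF lower_step_mem _ _ le])
    show "f \<in> L0" using assms(2) subset_L0 by auto
    show "AE s in unit_leb. incseq (\<lambda>k. lower_step f k s) \<and> (\<lambda>k. lower_step f k s) \<longlonglongrightarrow> f s"
      using C f.lower_step_incseq by (intro AE_unit_lebI[of C]) auto
  qed (use f.lower_step_nonneg in auto)
qed

text \<open>Both functions are brought to a common fine grid, where
  \<open>weak_majorization_le\<close> applies to \<open>c\<close> times the step function and a
  dyadic minorant of \<open>v\<close>. The factor \<open>c\<close> makes room for replacing
  \<open>v\<close> by its minorant.\<close>

lemma norm_step_le_of_head_integral_le:
  assumes v: "decreasing_fun v" "v \<in> E" and c: "0 < c" "c < 1"
    and a_nonneg: "\<And>j. 0 \<le> a j" and a_antimono: "\<And>i j. i \<le> j \<Longrightarrow> a j \<le> a i"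
    and head: "\<And>t. 0 < t \<Longrightarrow> t \<le> 1 \<Longrightarrow> head_integral (step_fun (2 ^ m) a) t \<le> head_integral v t"
  shows "c * N (step_fun (2 ^ m) a) \<le> N v"
proof -
  interpret v: decreasing_fun v by fact
  define n :: nat where "n = 2 ^ m"
  define b where "b k j = real_of_ereal (v (real (Suc j) / 2 ^ k))" for k j
  have n: "0 < n" by (simp add: n_def)
  have low: "lower_step v k = step_fun (2 ^ k) (b k)" for k
    by (simp add: lower_step_def b_def[abs_def])
  have b_nonneg: "0 \<le> b k j" for k j by (simp add: b_def real_of_ereal_pos v.nonneg)
  have b_antimono: "b k j \<le> b k i" if "i \<le> j" for k i j
    unfolding b_def
    by (rule real_of_ereal_positive_mono)
      (use that in \<open>auto intro!: v.nonneg v.finite antimonoD[OF v.antimono] divide_right_mono\<close>)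
  \<comment> \<open>The factor \<open>c < 1\<close> gives a strict inequality at each of the
    finitely many grid points, so one \<open>k\<close> can serve them all. If the partial sum is
    zero the bound is trivial.\<close>
  have "eventually (\<lambda>k. ennreal (c * (sum a {..<j} / n)) \<le> head_integral (lower_step v k) (j / n)) sequentially"
    if j: "j \<le> n" for j
  proof (cases "sum a {..<j} = 0")
    case False
    then have "0 < sum a {..<j}" using a_nonneg by (simp add: sum_nonneg order_less_le)
    then have "0 < sum a {..<j} / n" using n by simp
    then have "c * (sum a {..<j} / n) < sum a {..<j} / n"
      using c mult_strict_right_mono[of c 1 "sum a {..<j} / n"] by simp
    then have "ennreal (c * (sum a {..<j} / n)) < ennreal (sum a {..<j} / n)"
      by (rule ennreal_lessI[OF \<open>0 < sum a {..<j} / n\<close>])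
    also have "\<dots> = head_integral (step_fun n a) (j / n)"
      using n a_nonneg by (simp add: head_integral_step_fun)
    also have "\<dots> \<le> head_integral v (j / n)"
      unfolding n_def using False j
      by (intro head[unfolded n_def]) (auto simp: n_def intro!: divide_pos_pos Nat.gr0I)
    finally show ?thesis
      by (intro eventually_mono[OF v.head_integral_lower_step] less_imp_le) simp_all
  qed simp
  then have "eventually (\<lambda>k. \<forall>j\<in>{..n}. ennreal (c * (sum a {..<j} / n)) \<le> head_integral (lower_step v k) (j / n)) sequentially"
    by (intro eventually_ball_finite) auto
  then have "eventually (\<lambda>k. m \<le> k \<and> (\<forall>j\<in>{..n}. ennreal (c * (sum a {..<j} / n)) \<le> head_integral (lower_step v k) (j / n))) sequentially"
    by (intro eventually_conj eventually_ge_at_top)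
  then obtain k where k: "m \<le> k"
    and le: "\<And>j. j \<le> n \<Longrightarrow> ennreal (c * (sum a {..<j} / n)) \<le> head_integral (lower_step v k) (j / n)"
    by (auto simp: eventually_sequentially)
  \<comment> \<open>Each coarse cell consists of \<open>B\<close> fine ones, and \<open>a'\<close>
    repeats every scaled coefficient \<open>B\<close> times.\<close>
  define B :: nat where "B = 2 ^ (k - m)"
  define M :: nat where "M = 2 ^ k"
  have M: "M = n * B" "0 < M" "0 < B" using k by (auto simp: M_def n_def B_def power_add[symmetric])
  define a' where "a' i = c * a (i div B)" for i
  have sum_a': "sum a' {..<q * B} = c * real B * sum a {..<q}" for q
  proof -
    have "sum a' {..<q * B} = (\<Sum>m<q. sum a' {m * B..<m * B + B})" by (rule sum.nat_group[symmetric])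
    also have "\<dots> = (\<Sum>m<q. \<Sum>i\<in>{m * B..<m * B + B}. c * a m)"
    proof (intro sum.cong refl)
      fix m i assume "i \<in> {m * B..<m * B + B}"
      then have "i div B = m" using M(3) by (intro div_nat_eqI) (auto simp: algebra_simps)
      then show "a' i = c * a m" by (simp add: a'_def)
    qed
    also have "\<dots> = c * real B * sum a {..<q}" by (simp add: sum_distrib_left mult_ac)
    finally show ?thesis .
  qed
  have block: "sum a' {..<q * B} \<le> sum (b k) {..<q * B}" if q: "q \<le> n" for q
  proof -
    have "real q / real n = real (q * B) / real M" using M by simp
    then have "head_integral (lower_step v k) (q / n) = ennreal (sum (b k) {..<q * B} / M)"
      unfolding low M_def[symmetric] using head_integral_step_fun[of M "q * B" "b k"] M(2) b_nonneg by simp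
    then have "c * (sum a {..<q} / n) \<le> sum (b k) {..<q * B} / M"
      using le[OF q] by (simp add: ennreal_le_iff sum_nonneg b_nonneg)
    then have "c * (sum a {..<q} / n) * M \<le> sum (b k) {..<q * B}"
      using M by (simp add: pos_le_divide_eq)
    moreover have "c * (sum a {..<q} / n) * M = sum a' {..<q * B}"
      using n by (simp add: sum_a' M(1))
    ultimately show ?thesis by simp
  qed
  have "N (step_fun M a') \<le> N (step_fun M (b k))"
  proof (rule weak_majorization_le[where p = "\<lambda>a. N (step_fun M a)" and n = M])
    fix J assume J: "J \<le> M"
    show "sum a' {..<J} \<le> sum (b k) {..<J}"
    proof (cases "J = M")
      case True then show ?thesis using block[of n] M by simp
    next
      case False
      define q where "q = J div B"
      have J': "q * B \<le> J" "J \<le> Suc q * B"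
        using M(3) dividend_less_div_times[of B J] by (auto simp: q_def)
      have "q < n" using False J M by (simp add: q_def less_mult_imp_div_less)
      \<comment> \<open>Within a block \<open>a'\<close> is constant and \<open>b k\<close>
        decreases, so the inequality at the two ends of the block implies it in between.\<close>
      have "0 \<le> (\<Sum>i<J. b k i - a' i)"
      proof (rule partial_sums_nonneg_between[where p = "q * B" and q = "Suc q * B"])
        show "0 \<le> (\<Sum>i<q * B. b k i - a' i)" "0 \<le> (\<Sum>i<Suc q * B. b k i - a' i)"
          using block[of q] block[of "Suc q"] \<open>q < n\<close> by (simp_all only: sum_subtractf) auto
        fix i j assume ij: "q * B \<le> i" "i \<le> j" "j < Suc q * B"
        then have "i div B = q" "j div B = q" by (auto intro!: div_nat_eqI simp: algebra_simps)
        then show "b k j - a' j \<le> b k i - a' i" using b_antimono[OF ij(2), of k] by (simp add: a'_def)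
      qed (use J' in auto)
      then show ?thesis by (simp add: sum_subtractf)
    qed
  next
    fix i j assume "i \<le> j" "j < M"
    then show "a' j \<le> a' i" using c by (auto simp: a'_def intro!: a_antimono mult_left_mono div_le_mono)
  qed (use M c a_nonneg norm_step_fun_mono norm_step_fun_transfer in \<open>auto simp: a'_def\<close>)
  also have "\<dots> \<le> N v" using norm_lower_step(1)[OF v, of k] by (simp add: low M_def)
  \<comment> \<open>Dividing the fine cell index by \<open>B\<close> gives the coarse one, so the
    refined step function is \<open>c\<close> times the original.\<close>
  also have "N (step_fun M a') = N (\<lambda>s. ereal c * step_fun n a s)"
  proof (rule norm_cong_AE(2)[OF step_fun_L0 scale_mem[OF step_fun_mem]], rule AE_unit_lebI_all)
    fix s :: real assume s: "0 < s"
    have "\<lfloor>real n * s\<rfloor> = \<lfloor>real M * s / real_of_int (int B)\<rfloor>" using M by simp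
    also have "\<dots> = \<lfloor>real M * s\<rfloor> div int B" by (rule floor_divide_real_eq_div) simp
    finally have "nat \<lfloor>real M * s\<rfloor> div B = nat \<lfloor>real n * s\<rfloor>"
      using s by (simp add: nat_div_distrib)
    then show "step_fun M a' s = ereal c * step_fun n a s" by (simp add: step_fun_def a'_def)
  qed
  also have "\<dots> = c * N (step_fun n a)" using norm_scale[OF step_fun_mem, of c] c by simp
  finally show ?thesis by (simp add: n_def)
qed

text \<open>The dyadic minorants of \<open>u\<close> are step functions whose head integrals are
  below those of \<open>v\<close>. Letting \<open>c\<close> tend to \<open>1\<close> bounds their
  norms by that of \<open>v\<close>, and these norms tend to that of \<open>u\<close>.\<close>

lemma norm_le_of_head_integral_le:
  assumes u: "antimono u" "\<And>s. 0 \<le> u s" "u \<in> E" and v: "antimono v" "\<And>s. 0 \<le> v s" "v \<in> E"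
    and head: "\<And>t. 0 < t \<Longrightarrow> t \<le> 1 \<Longrightarrow> head_integral u t \<le> head_integral v t"
  shows "N u \<le> N v"
proof -
  have du: "decreasing_fun u" and dv: "decreasing_fun v"
    using u v by (auto intro: decreasing_fun_mem)
  interpret u: decreasing_fun u by fact
  have "N (lower_step u m) \<le> N v" for m
  proof (rule field_le_mult_one_interval)
    fix c :: real assume c: "0 < c" "c < 1"
    show "c * N (lower_step u m) \<le> N v"
      unfolding lower_step_def
    proof (rule norm_step_le_of_head_integral_le[OF dv v(3) c])
      fix i j :: nat assume "i \<le> j"
      then show "real_of_ereal (u (real (Suc j) / 2 ^ m)) \<le> real_of_ereal (u (real (Suc i) / 2 ^ m))"
        by (intro real_of_ereal_positive_mono)
          (auto intro!: u.nonneg u.finite antimonoD[OF u.antimono] divide_right_mono)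
    next
      fix t :: real assume t: "0 < t" "t \<le> 1"
      have "head_integral (lower_step u m) t \<le> head_integral u t"
        by (intro head_integral_mono u.lower_step_le) auto
      also have "\<dots> \<le> head_integral v t" by (rule head[OF t])
      finally show "head_integral (step_fun (2 ^ m) (\<lambda>j. real_of_ereal (u (real (Suc j) / 2 ^ m)))) t
          \<le> head_integral v t" by (simp add: lower_step_def)
    qed (use u in \<open>auto simp: real_of_ereal_pos\<close>)
  qed
  then show ?thesis by (intro LIMSEQ_le_const2[OF norm_lower_step(2)[OF du u(3)]]) auto
qed

end

section \<open>Order continuity and the fundamental function\<close>

lemma dist_fun_indicator:
  assumes "A \<in> sets unit_leb"
  shows "dist_fun (indicator A) l = (if l < 0 then 1 else if l < 1 then measure unit_leb A else 0)"
proof -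
  have A: "A \<subseteq> {0..<1}" using sets.sets_into_space[OF assms] by simp
  have "{s \<in> {0..<1}. \<bar>indicator A s :: ereal\<bar> > ereal l} = (if l < 1 then A else {})" if "0 \<le> l"
    using that A by (auto simp: indicator_def one_ereal_def zero_ereal_def)
  then show ?thesis by (simp add: dist_fun_neg) (simp add: dist_fun_def)
qed

definition excess :: "(real \<Rightarrow> ereal) \<Rightarrow> nat \<Rightarrow> real \<Rightarrow> ereal" where
  "excess x k = (\<lambda>s. max 0 (\<bar>x s\<bar> - ereal (real k)))"

lemma excess_nonneg [simp]: "0 \<le> excess x k s"
  by (simp add: excess_def)

lemma excess_le: "excess x k s \<le> \<bar>x s\<bar>"
  by (cases "x s") (auto simp: excess_def)

lemma le_excess_add: "\<bar>x s\<bar> \<le> excess x k s + ereal (real k)"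
  by (cases "x s") (auto simp: excess_def zero_ereal_def simp flip: ereal_max)

lemma excess_L0:
  assumes "x \<in> L0"
  shows "excess x k \<in> L0"
proof -
  have [measurable]: "x \<in> borel_measurable unit_leb" using assms by (simp add: L0_def)
  show ?thesis unfolding L0_def excess_def by measurable
qed

lemma dist_fun_excess: "dist_fun (excess x k) l = (if l < 0 then 1 else dist_fun x (l + real k))"
proof (cases "l < 0")
  case False
  have "ereal l < \<bar>excess x k s\<bar> \<longleftrightarrow> ereal (l + real k) < \<bar>x s\<bar>" for s
    using False by (cases "x s") (auto simp: excess_def zero_ereal_def simp flip: ereal_max)
  then show ?thesis using False by (simp add: dist_fun_def)
qed (simp add: dist_fun_neg)

definition cap :: "(real \<Rightarrow> ereal) \<Rightarrow> nat \<Rightarrow> real \<Rightarrow> ereal" where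
  "cap x k = (\<lambda>s. min \<bar>x s\<bar> (ereal (real k)))"

lemma cap_nonneg [simp]: "0 \<le> cap x k s"
  by (simp add: cap_def)

lemma cap_le: "cap x k s \<le> \<bar>x s\<bar>" "cap x k s \<le> ereal (real k)"
  by (simp_all add: cap_def)

lemma cap_L0:
  assumes "x \<in> L0"
  shows "cap x k \<in> L0"
proof -
  have [measurable]: "x \<in> borel_measurable unit_leb" using assms by (simp add: L0_def)
  show ?thesis unfolding L0_def cap_def by measurable
qed

lemma dist_fun_cap: "dist_fun (cap x k) l = (if l < real k then dist_fun x l else 0)"
proof -
  have "ereal l < \<bar>cap x k s\<bar> \<longleftrightarrow> l < real k \<and> ereal l < \<bar>x s\<bar>" for s
    by (cases "x s") (auto simp: cap_def simp flip: ereal_min)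
  then show ?thesis by (simp add: dist_fun_def)
qed

text \<open>Negative arguments are kept, so that cutting a nonnegative decreasing function leaves it
  decreasing on the whole line.\<close>

definition head_part :: "real \<Rightarrow> (real \<Rightarrow> ereal) \<Rightarrow> real \<Rightarrow> ereal" where
  "head_part t f = (\<lambda>s. if s < t then f s else 0)"

lemma head_part_nonneg: "0 \<le> f s \<Longrightarrow> 0 \<le> head_part t f s"
  by (simp add: head_part_def)

lemma antimono_head_part: "antimono f \<Longrightarrow> (\<And>s. 0 \<le> f s) \<Longrightarrow> antimono (head_part t f)"
  by (auto simp: head_part_def monotone_on_def)

lemma head_integral_head_part: "head_integral (head_part t f) u = head_integral f (min t u)"
  unfolding head_integral_def by (intro nn_integral_cong) (auto simp: head_part_def indicator_def e2ennreal_neg)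

text \<open>The subsequence principle: otherwise some subsequence stays a fixed distance away from
  \<open>0\<close>.\<close>

lemma real_tendsto_0_subseq:
  fixes a :: "nat \<Rightarrow> real"
  assumes "\<And>r. strict_mono r \<Longrightarrow> \<exists>q. strict_mono (q :: nat \<Rightarrow> nat) \<and> (\<lambda>n. a (r (q n))) \<longlonglongrightarrow> 0"
  shows "a \<longlonglongrightarrow> 0"
proof (rule ccontr)
  assume "\<not> a \<longlonglongrightarrow> 0"
  then obtain e where e: "0 < e" "\<not> eventually (\<lambda>n. dist (a n) 0 < e) sequentially"
    by (auto simp: tendsto_iff)
  then have "infinite {n. \<not> dist (a n) 0 < e}"
    unfolding cofinite_eq_sequentially[symmetric] eventually_cofinite by simp
  then obtain r where r: "strict_mono (r :: nat \<Rightarrow> nat)" "\<And>n. r n \<in> {n. \<not> dist (a n) 0 < e}"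
    using infinite_enumerate by blast
  obtain q where "(\<lambda>n. a (r (q n))) \<longlonglongrightarrow> 0" using assms[OF r(1)] by blast
  from tendstoD[OF this e(1)] obtain n where "dist (a (r (q n))) 0 < e"
    by (auto simp: eventually_sequentially)
  then show False using r(2)[of "q n"] by simp
qed

text \<open>On a finite measure space, convergence almost everywhere implies convergence in measure:
  the indicators of the level sets are dominated by \<open>1\<close>.\<close>

lemma measure_level_tendsto_0:
  assumes g: "\<And>n. g n \<in> L0" and lim: "AE s in unit_leb. (\<lambda>n. g n s) \<longlonglongrightarrow> 0" and e: "0 < e"
  shows "(\<lambda>n. dist_fun (g n) e) \<longlonglongrightarrow> 0"
proof -
  interpret finite_measure unit_leb by (rule finite_measure_unit_leb)
  define A where "A n = {s \<in> {0..<1}. \<bar>g n s\<bar> > ereal e}" for n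
  have A [measurable]: "A n \<in> sets unit_leb" for n
    unfolding A_def by (rule sets_unit_leb_level[OF g])
  have "(\<lambda>n. \<integral>s. indicator (A n) s \<partial>unit_leb) \<longlonglongrightarrow> (\<integral>s. (0::real) \<partial>unit_leb)"
  proof (rule integral_dominated_convergence[where w = "\<lambda>_. 1"])
    show "AE s in unit_leb. (\<lambda>n. indicator (A n) s :: real) \<longlonglongrightarrow> 0"
      using lim
    proof eventually_elim
      fix s assume "(\<lambda>n. g n s) \<longlonglongrightarrow> 0"
      then have "eventually (\<lambda>n. - ereal e < g n s) sequentially" "eventually (\<lambda>n. g n s < ereal e) sequentially"
        using e by (auto intro: order_tendstoD)
      then have "eventually (\<lambda>n. indicator (A n) s = (0::real)) sequentially"
      proof eventually_elim
        fix n assume "- ereal e < g n s" "g n s < ereal e"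
        then have "\<not> ereal e < \<bar>g n s\<bar>" by (cases "g n s") auto
        then show "indicator (A n) s = (0::real)" by (simp add: A_def)
      qed
      then show "(\<lambda>n. indicator (A n) s :: real) \<longlonglongrightarrow> 0" by (rule tendsto_eventually)
    qed
  qed (auto simp: indicator_def)
  moreover have "(\<integral>s. indicator (A n) s \<partial>unit_leb) = dist_fun (g n) e" for n
    using sets.sets_into_space[OF A[of n]] by (simp add: dist_fun_def A_def Int_absorb2)
  ultimately show ?thesis by simp
qed

section \<open>The fundamental function and bounded convergence in norm\<close>

context symmetric_space
begin

abbreviation phi :: "real \<Rightarrow> real" where
  "phi \<equiv> fundamental_fun N"

lemma mem_L0: "f \<in> E \<Longrightarrow> f \<in> L0"
  using subset_L0 by auto

lemma diff_mem:
  assumes "f \<in> E" "g \<in> E"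
  shows "(\<lambda>s. f s - g s) \<in> E"
proof -
  have "ereal (- 1) * a = - a" for a by (cases a) auto
  then show ?thesis using add_mem[OF assms(1) scale_mem[OF assms(2), of "- 1"]] by (simp only: minus_ereal_def)
qed

lemma indicator_mem:
  assumes "(indicator A :: real \<Rightarrow> ereal) \<in> L0"
  shows "(indicator A :: real \<Rightarrow> ereal) \<in> E"
  using assms by (rule bounded_mem[where c = 1]) (auto simp: indicator_def)

lemma indicator_ivl_mem: "(indicator {0<..<t::real} :: real \<Rightarrow> ereal) \<in> E"
  by (intro indicator_mem) (simp add: L0_def measurable_unit_leb)

lemma norm_indicator:
  assumes "A \<in> sets unit_leb"
  shows "N (indicator A) = phi (measure unit_leb A)"
proof -
  define m where "m = measure unit_leb A"
  have m: "0 \<le> m" "m \<le> 1" by (simp_all add: m_def measure_unit_leb_le_1)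
  have "{0<..<m} \<in> sets unit_leb" using m by (auto simp: sets_restrict_space_iff)
  moreover have "measure unit_leb {0<..<m} = m" using m by (subst measure_unit_leb) auto
  ultimately have "dist_fun (indicator A) = dist_fun (indicator {0<..<m})"
    using assms by (auto simp: dist_fun_indicator m_def)
  moreover have "(indicator A :: real \<Rightarrow> ereal) \<in> L0" using assms by (simp add: L0_def)
  ultimately have "N (indicator A) = N (indicator {0<..<m})"
    by (intro symmetric[THEN conjunct2] indicator_ivl_mem)
  then show ?thesis by (simp add: fundamental_fun_def m_def)
qed

lemma phi_mono:
  assumes "s \<le> t"
  shows "phi s \<le> phi t"
  unfolding fundamental_fun_def
  by (rule norm_mono(2)[OF mem_L0[OF indicator_ivl_mem] indicator_ivl_mem]) (use assms in \<open>auto simp: indicator_def\<close>)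

lemma phi_pos:
  assumes "0 < t"
  shows "0 < phi t"
proof -
  interpret finite_measure unit_leb by (rule finite_measure_unit_leb)
  have "phi t \<noteq> 0"
  proof
    assume "phi t = 0"
    then have "AE s in unit_leb. (indicator {0<..<t} s :: ereal) = 0"
      using norm_zero_iff[OF indicator_ivl_mem] by (simp add: fundamental_fun_def)
    then have "measure unit_leb {0<..<min t 1} = measure unit_leb {}"
      by (intro finite_measure_eq_AE) (auto simp: sets_restrict_space_iff indicator_def elim!: eventually_mono split: if_splits)
    moreover have "measure unit_leb {0<..<min t 1} = min t 1"
      using assms by (subst measure_unit_leb) auto
    ultimately show False using assms by simp
  qed
  moreover have "0 \<le> phi t"
    unfolding fundamental_fun_def by (rule norm_nonneg[OF indicator_ivl_mem])
  ultimately show ?thesis by simp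
qed

text \<open>Since \<open>phi\<close> is increasing, this says that its right limit at
  \<open>0\<close> is zero.\<close>

definition vanishing_phi :: bool where
  "vanishing_phi \<longleftrightarrow> (\<forall>e>0. \<exists>d>0. phi d < e)"

text \<open>Where \<open>g n\<close> is at most \<open>h\<close> in modulus it contributes at most
  \<open>h * norm_one\<close>; the remaining set has small measure and contributes at most
  \<open>\<bar>c\<bar>\<close> times a small value of \<open>phi\<close>.\<close>

lemma bounded_convergence:
  assumes phi: vanishing_phi and g: "\<And>n. g n \<in> L0"
    and c: "\<And>n. AE s in unit_leb. \<bar>g n s\<bar> \<le> ereal c"
    and lim: "AE s in unit_leb. (\<lambda>n. g n s) \<longlonglongrightarrow> 0"
  shows "(\<lambda>n. N (g n)) \<longlonglongrightarrow> 0"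
proof (rule LIMSEQ_I)
  fix e :: real assume e: "0 < e"
  have one: "0 \<le> norm_one" unfolding norm_one_def by (rule norm_nonneg[OF one_mem])
  \<comment> \<open>The summand \<open>1\<close> here and in the bound on \<open>phi d\<close> keeps
    the denominators positive.\<close>
  define h where "h = e / (2 * (norm_one + 1))"
  have h: "0 < h" "h * norm_one < e / 2"
    using e one by (auto simp: h_def field_simps)
  have "0 < e / (2 * (\<bar>c\<bar> + 1))" using e by (simp add: add_nonneg_pos)
  then obtain d where d: "0 < d" "phi d < e / (2 * (\<bar>c\<bar> + 1))"
    using phi unfolding vanishing_phi_def by blast
  have cphi: "\<bar>c\<bar> * phi d < e / 2"
  proof -
    have "\<bar>c\<bar> * phi d \<le> (\<bar>c\<bar> + 1) * phi d" using phi_pos[OF d(1)] by (simp add: distrib_right)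
    also have "\<dots> < (\<bar>c\<bar> + 1) * (e / (2 * (\<bar>c\<bar> + 1)))"
      by (rule mult_strict_left_mono[OF d(2)]) simp
    also have "\<dots> = e / 2" by (simp add: field_simps)
    finally show ?thesis .
  qed
  have "eventually (\<lambda>n. dist_fun (g n) h < d) sequentially"
    using measure_level_tendsto_0[OF g lim h(1)] d(1) by (rule order_tendstoD)
  then obtain n0 where n0: "\<And>n. n \<ge> n0 \<Longrightarrow> dist_fun (g n) h < d" by (auto simp: eventually_sequentially)
  show "\<exists>no. \<forall>n\<ge>no. norm (N (g n) - 0) < e"
  proof (intro exI allI impI)
    fix n assume n: "n \<ge> n0"
    define A where "A = {s \<in> {0..<1}. \<bar>g n s\<bar> > ereal h}"
    have A: "A \<in> sets unit_leb" unfolding A_def by (rule sets_unit_leb_level[OF g])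
    then have iA: "(indicator A :: real \<Rightarrow> ereal) \<in> E" by (intro indicator_mem) (simp add: L0_def)
    have "AE s in unit_leb. s \<in> {0..<1}" by (rule AE_I2) simp
    then have "AE s in unit_leb. \<bar>g n s\<bar> \<le> \<bar>ereal h\<bar> + \<bar>ereal c * indicator A s\<bar>"
      using c[of n]
      by eventually_elim (use h(1) in \<open>auto simp: A_def indicator_def not_less intro: add_increasing order_trans\<close>)
    from norm_le_add[OF g const_mem scale_mem[OF iA] this]
    have gE: "g n \<in> E" and "N (g n) \<le> N (\<lambda>s. ereal h) + N (\<lambda>s. ereal c * indicator A s)" by auto
    note this(2)
    also have "\<dots> = h * norm_one + \<bar>c\<bar> * phi (dist_fun (g n) h)"
      using h by (simp add: norm_const norm_scale[OF iA] norm_indicator[OF A]) (simp add: dist_fun_def A_def)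
    also have "\<dots> \<le> h * norm_one + \<bar>c\<bar> * phi d"
      using n0[OF n] by (intro add_left_mono mult_left_mono phi_mono) auto
    also have "\<dots> < e" using h cphi by simp
    finally show "norm (N (g n) - 0) < e" using norm_nonneg[OF gE] by simp
  qed
qed

section \<open>Order continuity in terms of excesses and the fundamental function\<close>

lemma excess_mem: "x \<in> E \<Longrightarrow> excess x k \<in> E"
  by (rule norm_mono(1)[OF excess_L0[OF mem_L0]]) (auto intro: order_trans[OF excess_le])

lemma cap_mem: "x \<in> E \<Longrightarrow> cap x k \<in> E"
  by (rule norm_mono(1)[OF cap_L0[OF mem_L0]]) (auto simp: cap_le)

lemma norm_excess_decr_rearr:
  assumes "x \<in> E"
  shows "N (excess (decr_rearr x) k) = N (excess x k)"
proof -
  have "dist_fun (excess (decr_rearr x) k) = dist_fun (excess x k)"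
    using dist_fun_decr_rearr[OF mem_L0[OF assms]] by (simp add: fun_eq_iff dist_fun_excess)
  then show ?thesis
    using symmetric[OF excess_L0[OF decr_rearr_L0] excess_mem[OF assms]] by blast
qed

text \<open>Each \<open>X n\<close> is bounded by \<open>excess x k + cap (X n) k\<close>. The first
  summand is small uniformly in \<open>n\<close> for a suitable \<open>k\<close>; for this
  \<open>k\<close> the second tends to zero by bounded convergence.\<close>

lemma order_continuity_pointI:
  assumes phi: vanishing_phi and x: "x \<in> E" and tail: "(\<lambda>k. N (excess x k)) \<longlonglongrightarrow> 0"
  shows "order_continuity_point E N x"
  unfolding order_continuity_point_def
proof (intro conjI x allI impI)
  fix X
  assume X: "\<forall>n. X n \<in> E \<and> (AE s in unit_leb. 0 \<le> X n s \<and> X n s \<le> \<bar>x s\<bar>)"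
    and lim: "AE s in unit_leb. (\<lambda>n. X n s) \<longlonglongrightarrow> 0"
  show "(\<lambda>n. N (X n)) \<longlonglongrightarrow> 0"
  proof (rule LIMSEQ_I)
    fix e :: real assume e: "0 < e"
    obtain k where k: "N (excess x k) < e / 2"
      using order_tendstoD(2)[OF tail, of "e / 2"] e by (auto simp: eventually_sequentially)
    have X': "AE s in unit_leb. \<forall>n. 0 \<le> X n s \<and> X n s \<le> \<bar>x s\<bar>"
      using X by (intro AE_all_countable[THEN iffD2]) auto
    have "(\<lambda>n. N (cap (X n) k)) \<longlonglongrightarrow> 0"
    proof (rule bounded_convergence[OF phi])
      show "cap (X n) k \<in> L0" for n using X by (intro cap_L0 mem_L0) auto
      show "AE s in unit_leb. \<bar>cap (X n) k s\<bar> \<le> ereal (real k)" for n by (simp add: cap_le)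
      show "AE s in unit_leb. (\<lambda>n. cap (X n) k s) \<longlonglongrightarrow> 0"
        using lim X'
      proof eventually_elim
        fix s assume s: "(\<lambda>n. X n s) \<longlonglongrightarrow> 0" "\<forall>n. 0 \<le> X n s \<and> X n s \<le> \<bar>x s\<bar>"
        show "(\<lambda>n. cap (X n) k s) \<longlonglongrightarrow> 0"
          by (rule tendsto_sandwich[OF _ _ tendsto_const s(1)]) (use s(2) in \<open>auto simp: cap_def min.coboundedI1\<close>)
      qed
    qed
    then have "eventually (\<lambda>n. N (cap (X n) k) < e / 2) sequentially"
      using e by (intro order_tendstoD) auto
    then obtain n0 where n0: "\<And>n. n \<ge> n0 \<Longrightarrow> N (cap (X n) k) < e / 2" by (auto simp: eventually_sequentially)
    show "\<exists>no. \<forall>n\<ge>no. norm (N (X n) - 0) < e"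
    proof (intro exI allI impI)
      fix n assume "n \<ge> n0"
      have Xn: "X n \<in> E" using X by blast
      have "AE s in unit_leb. \<bar>X n s\<bar> \<le> \<bar>excess x k s\<bar> + \<bar>cap (X n) k s\<bar>"
        using X[THEN spec, THEN conjunct2, of n]
      proof eventually_elim
        fix s assume s: "0 \<le> X n s \<and> X n s \<le> \<bar>x s\<bar>"
        show "\<bar>X n s\<bar> \<le> \<bar>excess x k s\<bar> + \<bar>cap (X n) k s\<bar>"
        proof (cases "X n s \<le> ereal (real k)")
          case True
          then have "cap (X n) k s = X n s" using s by (simp add: cap_def)
          then show ?thesis using s by (simp add: add_increasing)
        next
          case False
          then have "cap (X n) k s = ereal (real k)" using s by (simp add: cap_def min_def)
          then show ?thesis using s order_trans[OF _ le_excess_add[of x s k]] by simp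
        qed
      qed
      from norm_le_add(2)[OF mem_L0[OF Xn] excess_mem[OF x] cap_mem[OF Xn] this]
      have "N (X n) < e" using n0[OF \<open>n \<ge> n0\<close>] k by simp
      then show "norm (N (X n) - 0) < e" using norm_nonneg[OF Xn] by simp
    qed
  qed
qed

text \<open>The excesses are themselves an admissible sequence: where \<open>x\<close> is finite
  they are eventually zero.\<close>

lemma order_continuity_point_excess:
  assumes "order_continuity_point E N x"
  shows "(\<lambda>k. N (excess x k)) \<longlonglongrightarrow> 0"
proof -
  have x: "x \<in> E" using assms by (simp add: order_continuity_point_def)
  have "AE s in unit_leb. (\<lambda>k. excess x k s) \<longlonglongrightarrow> 0"
    using finite_ae[OF x]
  proof eventually_elim
    fix s assume "\<bar>x s\<bar> \<noteq> \<infinity>"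
    then obtain r where r: "x s = ereal r" by (cases "x s") auto
    obtain k where "\<bar>r\<bar> < real k" using reals_Archimedean2 by blast
    then have "eventually (\<lambda>k. excess x k s = 0) sequentially"
      unfolding eventually_sequentially excess_def r
      by (intro exI[of _ k]) (auto simp: max_def zero_ereal_def)
    then show "(\<lambda>k. excess x k s) \<longlonglongrightarrow> 0" by (rule tendsto_eventually)
  qed
  moreover have "\<forall>k. excess x k \<in> E \<and> (AE s in unit_leb. 0 \<le> excess x k s \<and> excess x k s \<le> \<bar>x s\<bar>)"
    using excess_mem[OF x] excess_le by auto
  ultimately show ?thesis using assms by (simp add: order_continuity_point_def)
qed

lemma nonzero_level:
  assumes "x \<in> E" "\<not> (AE s in unit_leb. x s = 0)"
  obtains m where "0 < m" "0 < dist_fun x m"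
proof -
  interpret finite_measure unit_leb by (rule finite_measure_unit_leb)
  have "dist_fun x 0 \<noteq> 0"
  proof
    assume "dist_fun x 0 = 0"
    then have "{s \<in> {0..<1}. \<bar>x s\<bar> > ereal 0} \<in> null_sets unit_leb"
      using sets_unit_leb_level[OF mem_L0[OF assms(1)], of "ereal 0"]
      by (intro null_setsI) (auto simp: dist_fun_def emeasure_eq_measure)
    then have "AE s in unit_leb. s \<notin> {s \<in> {0..<1}. \<bar>x s\<bar> > ereal 0}" by (rule AE_not_in)
    moreover have "AE s in unit_leb. s \<in> {0..<1}" by (rule AE_I2) simp
    ultimately have "AE s in unit_leb. x s = 0"
    proof eventually_elim
      fix s assume "s \<notin> {s \<in> {0..<1}. \<bar>x s\<bar> > ereal 0}" "s \<in> {0..<1}"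
      then show "x s = 0" by (cases "x s") auto
    qed
    then show False using assms(2) by simp
  qed
  then have "0 < dist_fun x 0" using dist_fun_nonneg[of x 0] by simp
  then show ?thesis using dist_fun_right_open[OF mem_L0[OF assms(1)]] that by blast
qed

text \<open>On a set \<open>A\<close> of positive measure \<open>\<bar>x\<bar>\<close> exceeds some
  \<open>m > 0\<close>. Subsets \<open>B n\<close> of \<open>A\<close> that have positive measure
  but shrink to a null set make \<open>m\<close> times their indicators an admissible sequence, so
  \<open>phi\<close> is small at positive arguments.\<close>

lemma order_continuity_point_vanishing_phi:
  assumes oc: "order_continuity_point E N x" and nz: "\<not> (AE s in unit_leb. x s = 0)"
  shows vanishing_phi
proof -
  interpret finite_measure unit_leb by (rule finite_measure_unit_leb)
  have x: "x \<in> E" using oc by (simp add: order_continuity_point_def)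
  obtain m where m: "0 < m" "0 < dist_fun x m" using nonzero_level[OF x nz] by blast
  define A where "A = {s \<in> {0..<1}. \<bar>x s\<bar> > ereal m}"
  have A: "A \<in> sets unit_leb" unfolding A_def by (rule sets_unit_leb_level[OF mem_L0[OF x]])
  have Ac: "A \<inter> {..<c} \<in> sets unit_leb" for c
    using A by (auto simp: sets_restrict_space_iff)
  define h where "h c = measure unit_leb (A \<inter> {..<c})" for c
  have h_mono: "h c \<le> h d" if "c \<le> d" for c d
    unfolding h_def using that Ac by (intro finite_measure_mono) auto
  \<comment> \<open>The essential left end of \<open>A\<close>: every interval reaching beyond
    \<open>c0\<close> to the right catches a part of \<open>A\<close> of positive measure.\<close>
  define c0 where "c0 = Inf {c. 0 < h c}"
  have "A \<inter> {..<1} = A" by (auto simp: A_def)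
  then have "1 \<in> {c. 0 < h c}" using m(2) by (simp add: h_def A_def dist_fun_def)
  moreover have "0 \<le> c" if "c \<in> {c. 0 < h c}" for c
  proof (rule ccontr)
    assume "\<not> 0 \<le> c"
    then have "A \<inter> {..<c} = {}" by (auto simp: A_def)
    then show False using that by (simp add: h_def)
  qed
  ultimately have ne: "{c. 0 < h c} \<noteq> {}" and bdd: "bdd_below {c. 0 < h c}"
    by (auto intro!: bdd_belowI[of _ 0])
  define B where "B n = A \<inter> {..<c0 + inverse (real (Suc n))}" for n
  have B: "B n \<in> sets unit_leb" for n unfolding B_def by (rule Ac)
  have B_pos: "0 < measure unit_leb (B n)" for n
  proof -
    obtain c where "0 < h c" "c < c0 + inverse (real (Suc n))"
      using cInf_lessD[OF ne, of "c0 + inverse (real (Suc n))"] by (auto simp: c0_def)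
    then show ?thesis using h_mono[of c "c0 + inverse (real (Suc n))"] by (simp add: B_def h_def)
  qed
  \<comment> \<open>To the left of \<open>c0\<close> only a null part of \<open>A\<close> remains,
    so \<open>B n\<close> effectively lies between \<open>c0\<close> and
    \<open>c0 + 1/(n+1)\<close>.\<close>
  have "AE s in unit_leb. s \<notin> A \<inter> {..<c0 - inverse (real (Suc n))}" for n
  proof -
    have "\<not> 0 < h (c0 - inverse (real (Suc n)))"
      using cInf_lower[OF _ bdd, of "c0 - inverse (real (Suc n))"] by (auto simp: c0_def)
    then have "measure unit_leb (A \<inter> {..<c0 - inverse (real (Suc n))}) = 0"
      unfolding h_def using measure_nonneg[of unit_leb] by (meson antisym not_less)
    then show ?thesis
      using Ac by (intro AE_not_in null_setsI) (auto simp: emeasure_eq_measure)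
  qed
  then have "AE s in unit_leb. \<forall>n. s \<notin> A \<inter> {..<c0 - inverse (real (Suc n))}"
    by (intro AE_all_countable[THEN iffD2] allI)
  moreover have "AE s in unit_leb. s \<noteq> c0" by (rule AE_unit_lebI[of "{c0}"]) auto
  ultimately have lim: "AE s in unit_leb. (\<lambda>n. ereal m * indicator (B n) s) \<longlonglongrightarrow> 0"
  proof eventually_elim
    fix s assume s: "\<forall>n. s \<notin> A \<inter> {..<c0 - inverse (real (Suc n))}" "s \<noteq> c0"
    have "eventually (\<lambda>n. s \<notin> B n) sequentially"
    proof (cases "c0 < s")
      case True
      then obtain n0 where n0: "inverse (real (Suc n0)) < s - c0" using reals_Archimedean[of "s - c0"] by auto
      have "s \<notin> B n" if "n0 \<le> n" for n
      proof -
        have "inverse (real (Suc n)) \<le> inverse (real (Suc n0))"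
          using that by (intro le_imp_inverse_le) auto
        with n0 have "c0 + inverse (real (Suc n)) \<le> s" by linarith
        then show ?thesis by (simp add: B_def)
      qed
      then show ?thesis by (auto simp: eventually_sequentially)
    next
      case False
      then obtain n where "inverse (real (Suc n)) < c0 - s" using reals_Archimedean[of "c0 - s"] s(2) by auto
      then have "s \<notin> A" using s(1) by (auto dest!: spec[of _ n])
      then show ?thesis by (simp add: B_def)
    qed
    then have "eventually (\<lambda>n. ereal m * indicator (B n) s = 0) sequentially"
      by (rule eventually_mono) simp
    then show "(\<lambda>n. ereal m * indicator (B n) s) \<longlonglongrightarrow> 0" by (rule tendsto_eventually)
  qed
  have iB: "(indicator (B n) :: real \<Rightarrow> ereal) \<in> E" for n
    using B by (intro indicator_mem) (simp add: L0_def)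
  have "(\<lambda>n. N (\<lambda>s. ereal m * indicator (B n) s)) \<longlonglongrightarrow> 0"
  proof (rule oc[unfolded order_continuity_point_def, THEN conjunct2, rule_format, OF _ lim])
    fix n
    have "AE s in unit_leb. 0 \<le> ereal m * indicator (B n) s \<and> ereal m * indicator (B n) s \<le> \<bar>x s\<bar>"
      using m(1) by (intro AE_I2) (auto simp: B_def A_def indicator_def)
    then show "(\<lambda>s. ereal m * indicator (B n) s) \<in> E \<and>
        (AE s in unit_leb. 0 \<le> ereal m * indicator (B n) s \<and> ereal m * indicator (B n) s \<le> \<bar>x s\<bar>)"
      using scale_mem[OF iB] by blast
  qed
  then have *: "(\<lambda>n. m * phi (measure unit_leb (B n))) \<longlonglongrightarrow> 0"
    using m(1) by (simp add: norm_scale[OF iB] norm_indicator[OF B])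
  show ?thesis unfolding vanishing_phi_def
  proof (intro allI impI)
    fix e :: real assume "0 < e"
    then have "eventually (\<lambda>n. m * phi (measure unit_leb (B n)) < m * e) sequentially"
      using m(1) by (intro order_tendstoD[OF *]) auto
    then obtain n where "m * phi (measure unit_leb (B n)) < m * e" by (auto simp: eventually_sequentially)
    then show "\<exists>d>0. phi d < e" using m(1) B_pos[of n] by auto
  qed
qed

text \<open>The rearrangement is at most its excess over \<open>k\<close> plus \<open>k\<close>.
  First \<open>k\<close> makes the excess small, then \<open>t\<close> makes
  \<open>k * phi t\<close> small.\<close>

lemma norm_head_part_decr_rearr_small:
  assumes phi: vanishing_phi and x: "x \<in> E" and tail: "(\<lambda>k. N (excess x k)) \<longlonglongrightarrow> 0" and e: "0 < e"
  obtains t where "0 < t" "t < 1" "N (head_part t (decr_rearr x)) < e"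
proof -
  obtain k where k: "N (excess x k) < e / 2"
    using order_tendstoD(2)[OF tail, of "e / 2"] e by (auto simp: eventually_sequentially)
  have "0 < e / (2 * (real k + 1))" using e by simp
  then obtain d where d: "0 < d" "phi d < e / (2 * (real k + 1))"
    using phi unfolding vanishing_phi_def by blast
  define t where "t = min d (1 / 2)"
  have t: "0 < t" "t < 1" using d by (auto simp: t_def)
  have "phi t \<le> phi d" by (intro phi_mono) (simp add: t_def)
  then have "real k * phi t \<le> (real k + 1) * phi d"
    using phi_pos[OF t(1)] phi_pos[OF d(1)] by (intro mult_mono) auto
  also have "\<dots> < (real k + 1) * (e / (2 * (real k + 1)))"
    by (rule mult_strict_left_mono[OF d(2)]) simp
  also have "\<dots> = e / 2" by (simp add: field_simps)
  finally have kphi: "real k * phi t < e / 2" .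
  have hL0: "head_part t (decr_rearr x) \<in> L0"
    by (intro antimono_L0 antimono_head_part antimono_decr_rearr decr_rearr_nonneg)
  have "N (head_part t (decr_rearr x)) \<le> N (excess (decr_rearr x) k) + N (\<lambda>s. ereal (real k) * indicator {0<..<t} s)"
  proof (rule norm_le_add(2)[OF hL0 excess_mem[OF decr_rearr_mem[OF x]] scale_mem[OF indicator_ivl_mem]], rule AE_unit_lebI_all)
    fix s :: real assume "0 < s" "s < 1"
    then show "\<bar>head_part t (decr_rearr x) s\<bar> \<le> \<bar>excess (decr_rearr x) k s\<bar> + \<bar>ereal (real k) * indicator {0<..<t} s\<bar>"
      using le_excess_add[of "decr_rearr x" s k] by (auto simp: head_part_def indicator_def)
  qed
  also have "\<dots> = N (excess x k) + real k * phi t"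
    by (simp add: norm_excess_decr_rearr[OF x] norm_scale[OF indicator_ivl_mem] fundamental_fun_def)
  also have "\<dots> < e" using k kphi by simp
  finally show ?thesis using t by (intro that[of t])
qed

section \<open>Values of rearrangements\<close>

lemma decr_rearr_finite:
  assumes "x \<in> E" "0 < t"
  shows "\<bar>decr_rearr x t\<bar> \<noteq> \<infinity>"
proof -
  interpret decreasing_fun "decr_rearr x"
    using assms by (intro decreasing_fun_mem antimono_decr_rearr decr_rearr_nonneg decr_rearr_mem)
  show ?thesis using finite[OF assms(2)] nonneg[of t] by auto
qed

text \<open>Before \<open>t\<close> the rearrangement is at least its value at \<open>t\<close>.
  Taking \<open>u = t\<close> gives a pointwise bound in terms of the norm; a fixed \<open>u\<close>
  controls the product as \<open>t\<close> tends to \<open>0\<close>.\<close>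

lemma decr_rearr_phi_le:
  assumes x: "x \<in> E" and t: "0 < t" "t \<le> u"
  shows "real_of_ereal (decr_rearr x t) * phi t \<le> N (head_part u (decr_rearr x))"
proof -
  define r where "r = real_of_ereal (decr_rearr x t)"
  have r: "decr_rearr x t = ereal r" using decr_rearr_finite[OF x t(1)] by (simp add: r_def ereal_real)
  have "0 \<le> r" using decr_rearr_nonneg[of x t] r by simp
  have hL0: "head_part u (decr_rearr x) \<in> L0"
    by (intro antimono_L0 antimono_head_part antimono_decr_rearr decr_rearr_nonneg)
  have hE: "head_part u (decr_rearr x) \<in> E"
    by (rule norm_mono(1)[OF hL0 decr_rearr_mem[OF x]]) (auto simp: head_part_def decr_rearr_nonneg)
  have "N (\<lambda>s. ereal r * indicator {0<..<t} s) \<le> N (head_part u (decr_rearr x))"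
  proof (rule norm_mono(2)[OF mem_L0[OF scale_mem[OF indicator_ivl_mem]] hE], rule AE_I2)
    fix s
    show "\<bar>ereal r * indicator {0<..<t} s\<bar> \<le> \<bar>head_part u (decr_rearr x) s\<bar>"
    proof (cases "s \<in> {0<..<t}")
      case True
      then have "ereal r \<le> decr_rearr x s" using antimonoD[OF antimono_decr_rearr, of s t x] r by simp
      then show ?thesis using True t \<open>0 \<le> r\<close> by (simp add: head_part_def decr_rearr_nonneg)
    qed simp
  qed
  then show ?thesis using \<open>0 \<le> r\<close> by (simp add: norm_scale[OF indicator_ivl_mem] fundamental_fun_def r)
qed

text \<open>A vanishing norm gives equality almost everywhere. It improves to equality everywhere
  because a rearrangement is determined by its distribution function.\<close>

lemma decr_rearr_eq_of_norm_diff: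
  assumes "x \<in> E" "y \<in> E" "N (\<lambda>s. decr_rearr x s - decr_rearr y s) = 0"
  shows "decr_rearr x = decr_rearr y"
proof -
  have "AE s in unit_leb. decr_rearr x s - decr_rearr y s = 0"
    using assms by (simp add: norm_zero_iff diff_mem decr_rearr_mem)
  moreover have "AE s in unit_leb. \<bar>decr_rearr x s\<bar> \<noteq> \<infinity>" "AE s in unit_leb. \<bar>decr_rearr y s\<bar> \<noteq> \<infinity>"
    using assms by (auto intro!: finite_ae decr_rearr_mem)
  ultimately have "AE s in unit_leb. decr_rearr x s = decr_rearr y s"
  proof eventually_elim
    case (elim s)
    then show ?case by (cases "decr_rearr x s"; cases "decr_rearr y s") (auto simp: zero_ereal_def)
  qed
  then have "dist_fun (decr_rearr x) = dist_fun (decr_rearr y)"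
    by (intro dist_fun_cong_AE decr_rearr_L0)
  then have "dist_fun x = dist_fun y" using assms mem_L0 by (simp add: dist_fun_decr_rearr)
  then show ?thesis by (rule decr_rearr_cong)
qed

end

section \<open>Points of lower K-monotonicity\<close>

context fatou_symmetric_space
begin

lemma norm_le_of_submajorized:
  assumes "x \<in> E" "y \<in> E" "submajorized y x"
  shows "N y \<le> N x"
proof -
  have "N (decr_rearr y) \<le> N (decr_rearr x)"
    using assms
    by (intro norm_le_of_head_integral_le antimono_decr_rearr decr_rearr_nonneg decr_rearr_mem)
      (auto simp: submajorized_iff)
  then show ?thesis using assms by (simp add: norm_decr_rearr)
qed

lemma head_part_decr_rearr_mem: "x \<in> E \<Longrightarrow> head_part t (decr_rearr x) \<in> E"
  by (rule norm_mono(1)[OF antimono_L0[OF antimono_head_part[OF antimono_decr_rearr]] decr_rearr_mem])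
    (auto simp: head_part_def decr_rearr_nonneg)

text \<open>Cutting both rearrangements at \<open>t\<close> merely replaces the upper limit
  \<open>u\<close> of the head integrals by \<open>min t u\<close>. This yields heads that are small
  uniformly over all elements submajorized by \<open>x\<close>.\<close>

lemma norm_head_part_le_of_submajorized:
  assumes "x \<in> E" "y \<in> E" "submajorized y x" "0 < t"
  shows "N (head_part t (decr_rearr y)) \<le> N (head_part t (decr_rearr x))"
  using assms
  by (intro norm_le_of_head_integral_le antimono_head_part antimono_decr_rearr decr_rearr_nonneg
      head_part_decr_rearr_mem)
    (auto simp: head_integral_head_part submajorized_iff head_part_nonneg decr_rearr_nonneg)

section \<open>Consequences of the LLUKM property\<close>

lemma LLUKM_point_LKM_point:
  assumes "LLUKM_point E N x"
  shows "LKM_point E N x"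
proof -
  have x: "x \<in> E" using assms by (simp add: LLUKM_point_def)
  have "N y < N x" if y: "y \<in> E" "decr_rearr x \<noteq> decr_rearr y" "submajorized y x" for y
  proof -
    have "N y \<noteq> N x"
    proof
      assume "N y = N x"
      then have "(\<lambda>n::nat. N (\<lambda>s. decr_rearr x s - decr_rearr y s)) \<longlonglongrightarrow> 0"
        using assms y unfolding LLUKM_point_def by (elim conjE allE[of _ "\<lambda>_. y"]) auto
      then have "N (\<lambda>s. decr_rearr x s - decr_rearr y s) = 0" by (simp add: LIMSEQ_const_iff)
      then show False using decr_rearr_eq_of_norm_diff[OF x y(1)] y(2) by simp
    qed
    then show ?thesis using norm_le_of_submajorized[OF x y(1,3)] by simp
  qed
  then show ?thesis using x by (simp add: LKM_point_def)
qed

lemma LLUKM_point_excess: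
  assumes "LLUKM_point E N x"
  shows "(\<lambda>k. N (excess x k)) \<longlonglongrightarrow> 0"
proof -
  have x: "x \<in> E" using assms by (simp add: LLUKM_point_def)
  have cap_sub: "submajorized (cap x k) x" for k
    unfolding submajorized_iff
    by (intro allI impI head_integral_mono decr_rearr_mono[OF mem_L0[OF x]]) (auto simp: cap_le)
  have "(\<lambda>k. N (cap x k)) \<longlonglongrightarrow> N (\<lambda>s. \<bar>x s\<bar>)"
  proof (rule fatouD(3)[where c = "N x"])
    show "N (cap x k) \<le> N x" for k
      by (rule norm_mono(2)[OF cap_L0[OF mem_L0[OF x]] x]) (auto simp: cap_le)
    show "AE s in unit_leb. incseq (\<lambda>k. cap x k s) \<and> (\<lambda>k. cap x k s) \<longlonglongrightarrow> \<bar>x s\<bar>"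
      using finite_ae[OF x]
    proof eventually_elim
      fix s assume "\<bar>x s\<bar> \<noteq> \<infinity>"
      then obtain r where r: "\<bar>x s\<bar> = ereal r" by (cases "x s") auto
      obtain k where k: "r < real k" using reals_Archimedean2 by blast
      have "eventually (\<lambda>k. cap x k s = \<bar>x s\<bar>) sequentially"
        unfolding eventually_sequentially cap_def r
        by (intro exI[of _ k]) (use k in \<open>auto simp: min_def\<close>)
      moreover have "incseq (\<lambda>k. cap x k s)"
        by (auto simp: incseq_def cap_def intro: min.coboundedI2)
      ultimately show "incseq (\<lambda>k. cap x k s) \<and> (\<lambda>k. cap x k s) \<longlonglongrightarrow> \<bar>x s\<bar>"
        by (simp add: tendsto_eventually)
    qed
  qed (use x in \<open>auto intro: cap_mem mem_L0 abs_mem\<close>)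
  then have "(\<lambda>k. N (cap x k)) \<longlonglongrightarrow> N x" using x by (simp add: norm_abs)
  then have lim: "(\<lambda>k. N (\<lambda>s. decr_rearr x s - decr_rearr (cap x k) s)) \<longlonglongrightarrow> 0"
    using assms cap_mem[OF x] cap_sub unfolding LLUKM_point_def by blast
  \<comment> \<open>Capping commutes with rearranging almost everywhere, so the difference is the
    excess of the rearrangement, which is equimeasurable with that of \<open>x\<close>.\<close>
  have "N (\<lambda>s. decr_rearr x s - decr_rearr (cap x k) s) = N (excess x k)" for k
  proof -
    let ?c = "\<lambda>s. cap (decr_rearr x) k s"
    have "dist_fun (cap x k) = dist_fun ?c"
      using dist_fun_decr_rearr[OF mem_L0[OF x]] by (simp add: fun_eq_iff dist_fun_cap)
    then have eq: "decr_rearr (cap x k) = decr_rearr ?c" by (rule decr_rearr_cong)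
    have "antimono ?c"
      using antimono_decr_rearr[of x]
      by (auto simp: cap_def monotone_on_def decr_rearr_nonneg intro: min.coboundedI1)
    then have "AE s in unit_leb. decr_rearr ?c s = ?c s" by (rule decr_rearr_antimono_AE) simp
    then have "AE s in unit_leb. decr_rearr x s - decr_rearr (cap x k) s = excess (decr_rearr x) k s"
      using finite_ae[OF decr_rearr_mem[OF x]]
    proof eventually_elim
      fix s assume s: "decr_rearr ?c s = ?c s" "\<bar>decr_rearr x s\<bar> \<noteq> \<infinity>"
      obtain r where r: "decr_rearr x s = ereal r" using s(2) by (cases "decr_rearr x s") auto
      have "0 \<le> r" using decr_rearr_nonneg[of x s] r by simp
      then have "?c s = ereal (min r (real k))" by (simp add: cap_def r)
      then have "decr_rearr (cap x k) s = ereal (min r (real k))" using s(1) by (simp only: eq)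
      then show "decr_rearr x s - decr_rearr (cap x k) s = excess (decr_rearr x) k s"
        using \<open>0 \<le> r\<close> r by (simp add: excess_def zero_ereal_def min_def max_def)
    qed
    then have "N (\<lambda>s. decr_rearr x s - decr_rearr (cap x k) s) = N (excess (decr_rearr x) k)"
      by (rule norm_cong_AE(2)[OF mem_L0[OF diff_mem[OF decr_rearr_mem[OF x] decr_rearr_mem[OF cap_mem[OF x]]]]
          excess_mem[OF decr_rearr_mem[OF x]]])
    then show ?thesis by (simp add: norm_excess_decr_rearr[OF x])
  qed
  then show ?thesis using lim by simp
qed

text \<open>A nonzero \<open>x\<close> has a rearrangement above some \<open>m > 0\<close> near the
  origin, so \<open>m * phi t\<close> is dominated by the product that tends to zero.\<close>

lemma vanishing_phi_of_limit:
  assumes x: "x \<in> E" and nz: "\<not> (AE s in unit_leb. x s = 0)"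
    and lim: "((\<lambda>t. decr_rearr x t * ereal (phi t)) \<longlongrightarrow> 0) (at_right 0)"
  shows vanishing_phi
  unfolding vanishing_phi_def
proof (intro allI impI)
  fix e :: real assume e: "0 < e"
  obtain m where m: "0 < m" "0 < dist_fun x m" using nonzero_level[OF x nz] by blast
  have "eventually (\<lambda>t. decr_rearr x t * ereal (phi t) < ereal (m * e)) (at_right 0)"
    using e m by (intro order_tendstoD(2)[OF lim]) auto
  then obtain b where b: "0 < b" "\<And>t. 0 < t \<Longrightarrow> t < b \<Longrightarrow> decr_rearr x t * ereal (phi t) < ereal (m * e)"
    by (auto simp: eventually_at_right_field)
  define t where "t = min (b / 2) (dist_fun x m / 2)"
  have t: "0 < t" "t < b" "t < dist_fun x m" using b m by (auto simp: t_def)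
  have "ereal m < decr_rearr x t" using t m by (simp add: less_decr_rearr_iff[OF mem_L0[OF x]])
  then have "ereal m * ereal (phi t) \<le> decr_rearr x t * ereal (phi t)"
    using phi_pos[OF t(1)] by (intro ereal_mult_right_mono) auto
  also have "\<dots> < ereal (m * e)" using b(2) t by blast
  finally have "m * phi t < m * e" by simp
  then show "\<exists>d>0. phi d < e" using m t by auto
qed

lemma LLUKM_point_order_continuity_point:
  assumes "LLUKM_point E N x" and "((\<lambda>t. decr_rearr x t * ereal (phi t)) \<longlongrightarrow> 0) (at_right 0)"
  shows "order_continuity_point E N x"
proof (cases "AE s in unit_leb. x s = 0")
  case False
  have x: "x \<in> E" using assms by (simp add: LLUKM_point_def)
  show ?thesis
    using vanishing_phi_of_limit[OF x False assms(2)] x LLUKM_point_excess[OF assms(1)]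
    by (rule order_continuity_pointI)
next
  \<comment> \<open>For a null function the limit condition gives no information on
    \<open>phi\<close>, but then every admissible sequence has norm zero.\<close>
  case True
  show ?thesis unfolding order_continuity_point_def
  proof (intro conjI allI impI)
    show "x \<in> E" using assms by (simp add: LLUKM_point_def)
    fix X assume X: "\<forall>n::nat. X n \<in> E \<and> (AE s in unit_leb. 0 \<le> X n s \<and> X n s \<le> \<bar>x s\<bar>)"
    have "N (X n) = 0" for n
    proof -
      have "AE s in unit_leb. X n s = 0"
        using X[THEN spec, THEN conjunct2, of n] True by eventually_elim auto
      then show ?thesis using X norm_zero_iff by blast
    qed
    then show "(\<lambda>n. N (X n)) \<longlonglongrightarrow> 0" by simp
  qed
qed

section \<open>The limit condition at points of order continuity\<close>

lemma decr_rearr_AE_0: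
  assumes "x \<in> E" "AE s in unit_leb. x s = 0" "0 < t"
  shows "decr_rearr x t = 0"
proof -
  have "dist_fun x = dist_fun (\<lambda>s. 0)"
    using assms zero_mem by (intro dist_fun_cong_AE mem_L0)
  from decr_rearr_cong[OF this] have "decr_rearr x t = decr_rearr (\<lambda>s. 0) t" by (rule fun_cong)
  also have "\<dots> \<le> 0" using assms(3) by (intro decr_rearr_le_antimono) (auto simp: monotone_on_def)
  finally show ?thesis using decr_rearr_nonneg[of x t] by simp
qed

lemma order_continuity_point_limit:
  assumes "order_continuity_point E N x"
  shows "((\<lambda>t. decr_rearr x t * ereal (phi t)) \<longlongrightarrow> 0) (at_right 0)"
proof -
  have x: "x \<in> E" using assms by (simp add: order_continuity_point_def)
  define r where "r t = real_of_ereal (decr_rearr x t)" for t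
  have r: "decr_rearr x t = ereal (r t)" "0 \<le> r t" if "0 < t" for t
    using decr_rearr_finite[OF x that] decr_rearr_nonneg[of x t]
    by (auto simp: r_def ereal_real real_of_ereal_pos)
  have "((\<lambda>t. r t * phi t) \<longlongrightarrow> 0) (at_right 0)"
  proof (rule tendstoI)
    fix e :: real assume e: "0 < e"
    obtain u where u: "0 < u" "\<And>t. 0 < t \<Longrightarrow> t \<le> u \<Longrightarrow> r t * phi t < e"
    proof (cases "AE s in unit_leb. x s = 0")
      case True
      show ?thesis by (rule that[of 1]) (simp_all add: r_def decr_rearr_AE_0[OF x True] e)
    next
      case False
      obtain u where "0 < u" "N (head_part u (decr_rearr x)) < e"
        using norm_head_part_decr_rearr_small[OF order_continuity_point_vanishing_phi[OF assms False] x
            order_continuity_point_excess[OF assms] e] by blast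
      then show ?thesis
        using that[of u] decr_rearr_phi_le[OF x, of _ u] by (fastforce simp: r_def)
    qed
    show "eventually (\<lambda>t. dist (r t * phi t) 0 < e) (at_right 0)"
      unfolding eventually_at_right_field
    proof (intro exI[of _ u] conjI allI impI)
      fix t assume "0 < t" "t < u"
      then show "dist (r t * phi t) 0 < e" using u(2)[of t] r(2)[of t] phi_pos[of t] by simp
    qed (rule u(1))
  qed
  then have "((\<lambda>t. ereal (r t * phi t)) \<longlongrightarrow> ereal 0) (at_right 0)" by (simp only: lim_ereal)
  moreover have "eventually (\<lambda>t. decr_rearr x t * ereal (phi t) = ereal (r t * phi t)) (at_right 0)"
    using r unfolding eventually_at_right_field by (intro exI[of _ 1]) auto
  ultimately show ?thesis by (simp add: zero_ereal_def tendsto_cong)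
qed

section \<open>Order continuity and LKM imply LLUKM\<close>

lemma LKM_point_subseq:
  assumes LKM: "LKM_point E N x" and phi: vanishing_phi and tail: "(\<lambda>k. N (excess x k)) \<longlonglongrightarrow> 0"
    and X: "\<And>n. X n \<in> E" "\<And>n. submajorized (X n) x" and lim: "(\<lambda>n. N (X n)) \<longlonglongrightarrow> N x"
  shows "\<exists>r. strict_mono (r :: nat \<Rightarrow> nat) \<and> (\<lambda>n. N (\<lambda>s. decr_rearr x s - decr_rearr (X (r n)) s)) \<longlonglongrightarrow> 0"
proof -
  have x: "x \<in> E" using LKM by (simp add: LKM_point_def)
  obtain r C where r: "strict_mono (r :: nat \<Rightarrow> nat)" and C: "countable C"
    and conv: "\<And>t. t \<notin> C \<Longrightarrow> (\<lambda>n. decr_rearr (X (r n)) t) \<longlonglongrightarrow> liminf (\<lambda>n. decr_rearr (X (r n)) t)"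
    using Helly_antimono[of "\<lambda>n. decr_rearr (X n)"] antimono_decr_rearr by blast
  define f where "f n = decr_rearr (X (r n))" for n
  \<comment> \<open>Taking the liminf at every point, exceptional ones included, makes
    \<open>y\<close> decreasing everywhere.\<close>
  define y where "y t = liminf (\<lambda>n. f n t)" for t
  have f: "antimono (f n)" "0 \<le> f n s" "f n \<in> E" "N (f n) = N (X (r n))" for n s
    unfolding f_def using X by (auto intro: antimono_decr_rearr decr_rearr_nonneg decr_rearr_mem norm_decr_rearr)
  have fy: "(\<lambda>n. f n t) \<longlonglongrightarrow> y t" if "t \<notin> C" for t
    using conv[OF that] by (simp add: f_def y_def)
  have y_anti: "antimono y"
    unfolding y_def using f(1) by (auto simp: monotone_on_def intro!: Liminf_mono)
  have y_nonneg: "0 \<le> y s" for s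
    unfolding y_def by (intro Liminf_bounded) (simp add: f)
  have limf: "(\<lambda>n. N (f n)) \<longlonglongrightarrow> N x"
    using LIMSEQ_subseq_LIMSEQ[OF lim r] by (simp add: f comp_def)
  obtain M where M: "\<And>n. N (f n) \<le> M"
    using convergent_imp_Bseq[OF convergentI[OF limf]] by (auto simp: Bseq_def abs_le_iff)
  \<comment> \<open>The infima over the tails of the sequence increase to \<open>y\<close> and lie
    below the \<open>f n\<close>, so their norms are bounded and the Fatou property applies.\<close>
  have y: "y \<in> E"
  proof (rule fatouD(1)[where X = "\<lambda>n t. INF m\<in>{n..}. f m t" and c = M])
    have anti: "antimono (\<lambda>t. INF m\<in>{n..}. f m t)" for n
      using f(1) by (auto simp: monotone_on_def intro!: INF_mono)
    have le: "AE s in unit_leb. \<bar>INF m\<in>{n..}. f m s\<bar> \<le> \<bar>f n s\<bar>" for n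
    proof (rule AE_I2)
      fix s
      have "0 \<le> (INF m\<in>{n..}. f m s)" by (intro INF_greatest f)
      moreover have "(INF m\<in>{n..}. f m s) \<le> f n s" by (rule INF_lower) simp
      ultimately show "\<bar>INF m\<in>{n..}. f m s\<bar> \<le> \<bar>f n s\<bar>" using f(2)[of n s] by simp
    qed
    note * = norm_mono[OF antimono_L0[OF anti] f(3) le]
    show "(\<lambda>t. INF m\<in>{n..}. f m t) \<in> E" for n by (rule *)
    show "N (\<lambda>t. INF m\<in>{n..}. f m t) \<le> M" for n using *(2)[of n] M[of n] by simp
    show "AE s in unit_leb. 0 \<le> (INF m\<in>{n..}. f m s)" for n
      by (intro AE_I2 INF_greatest f)
    show "y \<in> L0" by (rule antimono_L0[OF y_anti])
    have "incseq (\<lambda>n. INF m\<in>{n..}. f m s)" for s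
      by (auto simp: incseq_def intro!: INF_superset_mono)
    then show "AE s in unit_leb. incseq (\<lambda>n. INF m\<in>{n..}. f m s) \<and> (\<lambda>n. INF m\<in>{n..}. f m s) \<longlonglongrightarrow> y s"
      using LIMSEQ_SUP[of "\<lambda>n. INF m\<in>{n..}. f m _"] by (simp add: y_def liminf_SUP_INF)
  qed
  have y_x: "submajorized y x"
    unfolding submajorized_iff
  proof (intro allI impI)
    fix t :: real assume t: "0 < t"
    have [measurable]: "f n \<in> borel_measurable borel" for n by (rule borel_measurable_antimono[OF f(1)])
    have "AE s in lborel. s \<notin> C" using C by (intro AE_not_in countable_imp_null_set_lborel)
    then have AE: "AE s in lborel. e2ennreal (y s) * indicator {0<..<t} s
        = liminf (\<lambda>n. e2ennreal (f n s) * indicator {0<..<t} s)"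
    proof eventually_elim
      fix s assume "s \<notin> C"
      then have "(\<lambda>n. e2ennreal (f n s)) \<longlonglongrightarrow> e2ennreal (y s)" by (intro tendsto_e2ennrealI fy)
      then show "e2ennreal (y s) * indicator {0<..<t} s
        = liminf (\<lambda>n. e2ennreal (f n s) * indicator {0<..<t} s)"
        by (cases "s \<in> {0<..<t}") (simp_all add: lim_imp_Liminf Liminf_const)
    qed
    \<comment> \<open>Submajorization passes to the limit by Fatou's lemma for integrals.\<close>
    have "head_integral (decr_rearr y) t \<le> head_integral y t"
      by (intro head_integral_mono decr_rearr_le_antimono y_anti y_nonneg)
    also have "\<dots> = (\<integral>\<^sup>+s. liminf (\<lambda>n. e2ennreal (f n s) * indicator {0<..<t} s) \<partial>lborel)"
      unfolding head_integral_def by (rule nn_integral_cong_AE[OF AE])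
    also have "\<dots> \<le> liminf (\<lambda>n. head_integral (f n) t)"
      unfolding head_integral_def by (rule nn_integral_liminf) measurable
    also have "\<dots> \<le> liminf (\<lambda>n. head_integral (decr_rearr x) t)"
      using X(2) t by (intro Liminf_mono always_eventually) (auto simp: submajorized_iff f_def)
    finally show "head_integral (decr_rearr y) t \<le> head_integral (decr_rearr x) t"
      by (simp add: Liminf_const)
  qed
  define g where "g t n s = (if s < t then 0 else f n s - y s)" for t n s
  have g_bound: "\<bar>g t n s\<bar> \<le> ereal (M / phi t)" if t: "0 < t" for t n s
  proof (cases "s < t")
    case False
    \<comment> \<open>The common norm bound \<open>M\<close> limits all values at \<open>t\<close>,
      and monotonicity extends this to the right of \<open>t\<close>.\<close>
    have f_le: "f m s \<le> ereal (M / phi t)" for m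
    proof -
      have "f m t = ereal (real_of_ereal (f m t))"
        using decr_rearr_finite[OF X(1) t, of "r m"] by (simp add: f_def ereal_real)
      moreover have "real_of_ereal (f m t) \<le> M / phi t"
      proof -
        have "N (head_part t (f m)) \<le> N (f m)"
          unfolding f_def using X
          by (intro norm_mono(2) mem_L0 head_part_decr_rearr_mem decr_rearr_mem) (auto simp: head_part_def)
        then have "real_of_ereal (f m t) * phi t \<le> M"
          using decr_rearr_phi_le[OF X(1) t, of t "r m"] M[of m] by (simp add: f_def)
        then show ?thesis using phi_pos[OF t] by (simp add: field_simps)
      qed
      ultimately have "f m t \<le> ereal (M / phi t)" by (metis ereal_less_eq(3))
      then show ?thesis using antimonoD[OF f(1), of t s m] False by simp
    qed
    have "y s \<le> ereal (M / phi t)"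
    proof -
      have "y s \<le> liminf (\<lambda>n. ereal (M / phi t))"
        unfolding y_def using f_le by (intro Liminf_mono) auto
      then show ?thesis by (simp add: Liminf_const)
    qed
    then show ?thesis using f_le[of n] f(2)[of n s] y_nonneg[of s] False
      by (cases "f n s"; cases "y s") (auto simp: g_def)
  next
    case True
    have "0 \<le> M" using order_trans[OF norm_nonneg[OF f(3)] M] by blast
    then show ?thesis using True phi_pos[OF t] by (simp add: g_def)
  qed
  have [measurable]: "f n \<in> borel_measurable borel" "y \<in> borel_measurable borel" for n
    by (intro borel_measurable_antimono f y_anti)+
  have gL0: "g t n \<in> L0" for t n
    unfolding L0_def g_def by (intro measurable_unit_leb) measurable
  have gE: "g t n \<in> E" if "0 < t" for t n
    by (rule bounded_mem[OF gL0 AE_I2]) (rule g_bound[OF that])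
  have g_lim: "(\<lambda>n. N (g t n)) \<longlonglongrightarrow> 0" if t: "0 < t" for t
  proof (rule bounded_convergence[OF phi gL0])
    show "AE s in unit_leb. \<bar>g t n s\<bar> \<le> ereal (M / phi t)" for n by (rule AE_I2) (rule g_bound[OF t])
    show "AE s in unit_leb. (\<lambda>n. g t n s) \<longlonglongrightarrow> 0"
    proof (rule AE_unit_lebI[OF C])
      interpret y: decreasing_fun y by (intro decreasing_fun_mem y_anti y_nonneg y)
      fix s :: real assume s: "0 < s" "s \<notin> C"
      have "y s \<noteq> \<infinity>" "y s \<noteq> - \<infinity>" using y.finite[OF s(1)] y_nonneg[of s] by auto
      then have fin: "\<bar>y s\<bar> \<noteq> \<infinity>" by auto
      have "(\<lambda>n. f n s - y s) \<longlonglongrightarrow> y s - y s"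
        using fin by (intro tendsto_diff_ereal fy s tendsto_const)
      moreover have "y s - y s = 0" using fin by simp
      ultimately show "(\<lambda>n. g t n s) \<longlonglongrightarrow> 0" by (cases "s < t") (simp_all add: g_def)
    qed
  qed
  have head_f: "N (head_part t (f n)) \<le> N (head_part t (decr_rearr x))" if "0 < t" for t n
    unfolding f_def by (intro norm_head_part_le_of_submajorized x X that)
  have head_E: "head_part t (f n) \<in> E" for t n
    unfolding f_def by (intro head_part_decr_rearr_mem X)
  \<comment> \<open>Norm could be lost in the limit only near the origin. There the heads of all
    \<open>f n\<close> are below \<open>e\<close>, while the part from \<open>t\<close> on converges
    in norm.\<close>
  have "N x \<le> N y"
  proof (rule field_le_epsilon)
    fix e :: real assume e: "0 < e"
    obtain t where t: "0 < t" "N (head_part t (decr_rearr x)) < e"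
      using norm_head_part_decr_rearr_small[OF phi x tail e] by blast
    have "N (f n) \<le> N y + e + N (g t n)" for n
    proof -
      have "AE s in unit_leb. \<bar>f n s\<bar> \<le> \<bar>y s + head_part t (f n) s\<bar> + \<bar>g t n s\<bar>"
        using finite_ae[OF y] finite_ae[OF f(3)[of n]]
      proof eventually_elim
        fix s assume "\<bar>y s\<bar> \<noteq> \<infinity>" "\<bar>f n s\<bar> \<noteq> \<infinity>"
        then show "\<bar>f n s\<bar> \<le> \<bar>y s + head_part t (f n) s\<bar> + \<bar>g t n s\<bar>"
          using f(2)[of n s] y_nonneg[of s]
          by (cases "f n s"; cases "y s") (auto simp: head_part_def g_def)
      qed
      then have "N (f n) \<le> N (\<lambda>s. y s + head_part t (f n) s) + N (g t n)"
        using t by (intro norm_le_add(2) mem_L0 f add_mem y head_E gE)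
      also have "\<dots> \<le> N y + N (head_part t (f n)) + N (g t n)"
        using norm_triangle[OF y head_E] by simp
      also have "\<dots> \<le> N y + e + N (g t n)" using head_f[OF t(1), of n] t(2) by simp
      finally show ?thesis .
    qed
    moreover have "(\<lambda>n. N y + e + N (g t n)) \<longlonglongrightarrow> N y + e + 0"
      by (intro tendsto_intros g_lim t)
    ultimately show "N x \<le> N y + e"
      using LIMSEQ_le[OF limf, of "\<lambda>n. N y + e + N (g t n)" "N y + e + 0"] by auto
  qed
  \<comment> \<open>Otherwise the LKM property would give \<open>N y < N x\<close>.\<close>
  then have "decr_rearr x = decr_rearr y"
    using LKM y y_x unfolding LKM_point_def by (meson not_less)
  then have xy: "AE s in unit_leb. decr_rearr x s = y s"
    using decr_rearr_antimono_AE[OF y_anti y_nonneg] by simp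
  have "(\<lambda>n. N (\<lambda>s. decr_rearr x s - f n s)) \<longlonglongrightarrow> 0"
  proof (rule LIMSEQ_I)
    fix e :: real assume e: "0 < e"
    then have "0 < e / 4" by simp
    then obtain t where t: "0 < t" "N (head_part t (decr_rearr x)) < e / 4"
      using norm_head_part_decr_rearr_small[OF phi x tail] by blast
    have diffE: "(\<lambda>s. decr_rearr x s - f n s) \<in> E" for n
      by (intro diff_mem decr_rearr_mem x f)
    have le: "N (\<lambda>s. decr_rearr x s - f n s) \<le> e / 4 + e / 4 + N (g t n)" for n
    proof -
      \<comment> \<open>Before \<open>t\<close> the difference is bounded by the sum of the two
        small heads; from \<open>t\<close> on it is \<open>g t n\<close> up to sign.\<close>
      have "AE s in unit_leb. \<bar>decr_rearr x s - f n s\<bar>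
          \<le> \<bar>head_part t (decr_rearr x) s + head_part t (f n) s\<bar> + \<bar>g t n s\<bar>"
        using finite_ae[OF y] finite_ae[OF f(3)[of n]] xy
      proof eventually_elim
        fix s assume "\<bar>y s\<bar> \<noteq> \<infinity>" "\<bar>f n s\<bar> \<noteq> \<infinity>" "decr_rearr x s = y s"
        then show "\<bar>decr_rearr x s - f n s\<bar>
          \<le> \<bar>head_part t (decr_rearr x) s + head_part t (f n) s\<bar> + \<bar>g t n s\<bar>"
          using f(2)[of n s] y_nonneg[of s]
          by (cases "f n s"; cases "y s") (auto simp: head_part_def g_def)
      qed
      then have "N (\<lambda>s. decr_rearr x s - f n s)
          \<le> N (\<lambda>s. head_part t (decr_rearr x) s + head_part t (f n) s) + N (g t n)"
        using t by (intro norm_le_add(2) mem_L0 diffE add_mem head_part_decr_rearr_mem x head_E gE)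
      also have "\<dots> \<le> N (head_part t (decr_rearr x)) + N (head_part t (f n)) + N (g t n)"
        using norm_triangle[OF head_part_decr_rearr_mem[OF x] head_E] by simp
      also have "\<dots> \<le> e / 4 + e / 4 + N (g t n)" using head_f[OF t(1), of n] t(2) by simp
      finally show ?thesis .
    qed
    have "eventually (\<lambda>n. N (g t n) < e / 2) sequentially"
      using e by (intro order_tendstoD(2)[OF g_lim[OF t(1)]]) auto
    then obtain n0 where n0: "\<And>n. n \<ge> n0 \<Longrightarrow> N (g t n) < e / 2" by (auto simp: eventually_sequentially)
    show "\<exists>no. \<forall>n\<ge>no. norm (N (\<lambda>s. decr_rearr x s - f n s) - 0) < e"
    proof (intro exI allI impI)
      fix n assume "n \<ge> n0"
      then show "norm (N (\<lambda>s. decr_rearr x s - f n s) - 0) < e"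
        using le[of n] n0[of n] norm_nonneg[OF diffE, of n] by simp
    qed
  qed
  then show ?thesis using r by (auto simp: f_def)
qed

lemma LKM_point_LLUKM_point:
  assumes LKM: "LKM_point E N x" and oc: "order_continuity_point E N x"
  shows "LLUKM_point E N x"
proof -
  have x: "x \<in> E" using LKM by (simp add: LKM_point_def)
  have "(\<lambda>n. N (\<lambda>s. decr_rearr x s - decr_rearr (X n) s)) \<longlonglongrightarrow> 0"
    if X: "\<And>n. X n \<in> E" "\<And>n. submajorized (X n) x" and lim: "(\<lambda>n. N (X n)) \<longlonglongrightarrow> N x" for X :: "nat \<Rightarrow> real \<Rightarrow> ereal"
  proof (cases "AE s in unit_leb. x s = 0")
    case True
    \<comment> \<open>If \<open>x\<close> vanishes, submajorization forces every \<open>X n\<close>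
      to have norm zero; this case is separate because order continuity of zero says nothing about
      \<open>phi\<close>.\<close>
    then have N0: "N x = 0" using norm_zero_iff[OF x] by simp
    have "N (\<lambda>s. decr_rearr x s - decr_rearr (X n) s) = 0" for n
    proof -
      have "AE s in unit_leb. decr_rearr (X n) s = 0"
        using norm_zero_iff[OF decr_rearr_mem[OF X(1)], of n] norm_le_of_submajorized[OF x X(1,2), of n]
          norm_nonneg[OF X(1)[of n]] X(1)
        by (simp add: N0 norm_decr_rearr)
      then have "AE s in unit_leb. decr_rearr x s - decr_rearr (X n) s = 0"
        using norm_zero_iff[OF decr_rearr_mem[OF x]] N0 x
        by (auto simp: norm_decr_rearr elim!: eventually_elim2)
      then show ?thesis
        using norm_zero_iff[OF diff_mem[OF decr_rearr_mem[OF x] decr_rearr_mem[OF X(1)]]] by blast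
    qed
    then show ?thesis by simp
  next
    case False
    show ?thesis
    proof (rule real_tendsto_0_subseq)
      fix r :: "nat \<Rightarrow> nat" assume "strict_mono r"
      then show "\<exists>q. strict_mono (q :: nat \<Rightarrow> nat) \<and>
          (\<lambda>n. N (\<lambda>s. decr_rearr x s - decr_rearr (X (r (q n))) s)) \<longlonglongrightarrow> 0"
        using LIMSEQ_subseq_LIMSEQ[OF lim]
        by (intro LKM_point_subseq[OF LKM order_continuity_point_vanishing_phi[OF oc False]
              order_continuity_point_excess[OF oc]] X) (simp add: comp_def)
    qed
  qed
  then show ?thesis using x by (simp add: LLUKM_point_def)
qed

end

theorem theorem3p6:
  fixes E :: "(real \<Rightarrow> ereal) set" and N :: "(real \<Rightarrow> ereal) \<Rightarrow> real" and x :: "real \<Rightarrow> ereal"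
  assumes "symmetric_space E N"
    and "fatou_property E N"
    and "x \<in> E"
  shows "LLUKM_point E N x \<and>
      ((\<lambda>t. decr_rearr x t * ereal (fundamental_fun N t)) \<longlongrightarrow> 0) (at_right 0)
    \<longleftrightarrow> LKM_point E N x \<and> order_continuity_point E N x"
proof -
  interpret fatou_symmetric_space E N
    using assms by (simp add: fatou_symmetric_space_def fatou_symmetric_space_axioms_def)
  show ?thesis
    using LLUKM_point_LKM_point LLUKM_point_order_continuity_point LKM_point_LLUKM_point
      order_continuity_point_limit by blast
qed

end
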